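(* Every tetrahedron ($3$-dimensional simplex) $\mathcal{S}\subseteq\mathbb{R}^3$ has a (non-proper) cross-polytopal subdivision $\Delta$ such that $f_3(\Delta)=23$ and $\partial\Delta\simeq\partial\Diamond_3$.
   Context: The regular $d$-dimensional cross-polytope is $\Diamond_d=\mathrm{conv}(\pm e_1,\dots,\pm e_d)\subseteq\mathbb{R}^d$, with boundary complex $\partial\Diamond_d$ (the complex of its proper faces). A $d$-dimensional cross-polytope is any convex polytope whose face lattice is isomorphic to that of $\Diamond_d$. A (geometric) polytopal complex $\Delta$ in $\mathbb{R}^d$ is a finite collection of polytopes in $\mathbb{R}^d$ (its cells), closed under taking faces, such that the intersection of any two cells is a (possibly empty) face of both. It is pure if all maximal cells have the same dimension. A (geometric) cross-polytopal complex in $\mathbb{R}^d$ is a pure polytopal complex all of whose maximal cells are $d$-dimensional cross-polytopes. The support is $|\Delta|=\bigcup_{\mathcal{C}\in\Delta}\mathcal{C}$, and $\Delta$ is called a cross-polytopal subdivision of $|\Delta|$. The boundary $\partial\Delta$ is the simplicial complex generated by the $(d-1)$-dimensional cells of $\Delta$ that belong to a unique maximal cell. The symbol $\simeq$ denotes combinatorial equivalence (isomorphism of face posets). A cross-polytopal subdivision $\Delta$ of a simplicial polytope $\mathcal{P}$ is proper if $\partial\Delta\simeq\partial\mathcal{P}$, and non-proper otherwise. $f_i(\Delta)$ is the number of $i$-dimensional cells of $\Delta$. *)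

theory Defs
  imports "HOL-Analysis.Analysis"
begin

text \<open>
  Face lattices and complexes are sets of faces ordered by inclusion. Following the library's
  \<open>face_of\<close>, the empty set is a face of every polytope and every polytope is a face of itself;
  in particular a nonempty complex contains the empty cell.
\<close>

definition face_lattice :: "'a::euclidean_space set \<Rightarrow> 'a set set" where
  "face_lattice P = {F. F face_of P}"

definition boundary_complex :: "'a::euclidean_space set \<Rightarrow> 'a set set" where
  "boundary_complex P = {F. F face_of P \<and> F \<noteq> P}"

definition comb_equiv :: "'a set set \<Rightarrow> 'b set set \<Rightarrow> bool" (infix "\<simeq>\<^sub>c" 50) where
  "A \<simeq>\<^sub>c B \<longleftrightarrow>
     (\<exists>f. bij_betw f A B \<and> (\<forall>F\<in>A. \<forall>G\<in>A. F \<subseteq> G \<longleftrightarrow> f F \<subseteq> f G))"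

text \<open>The ambient space is \<open>'a\<close>; its dimension \<open>DIM('a)\<close> plays the role of \<open>d\<close> throughout.\<close>

definition regular_cross_polytope :: "'a::euclidean_space set" where
  "regular_cross_polytope = convex hull (Basis \<union> uminus ` Basis)"

definition cross_polytope :: "'a::euclidean_space set \<Rightarrow> bool" where
  "cross_polytope P \<longleftrightarrow>
     polytope P \<and> face_lattice P \<simeq>\<^sub>c face_lattice (regular_cross_polytope :: 'a set)"

definition polytopal_complex :: "'a::euclidean_space set set \<Rightarrow> bool" where
  "polytopal_complex \<Delta> \<longleftrightarrow>
     finite \<Delta> \<and>
     (\<forall>C\<in>\<Delta>. polytope C) \<and>
     (\<forall>C\<in>\<Delta>. \<forall>F. F face_of C \<longrightarrow> F \<in> \<Delta>) \<and>
     (\<forall>C\<in>\<Delta>. \<forall>D\<in>\<Delta>. (C \<inter> D) face_of C \<and> (C \<inter> D) face_of D)"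

definition maximal_cells :: "'a set set \<Rightarrow> 'a set set" where
  "maximal_cells \<Delta> = {C\<in>\<Delta>. \<forall>D\<in>\<Delta>. C \<subseteq> D \<longrightarrow> D = C}"

definition pure_complex :: "'a::euclidean_space set set \<Rightarrow> bool" where
  "pure_complex \<Delta> \<longleftrightarrow>
     (\<forall>C\<in>maximal_cells \<Delta>. \<forall>D\<in>maximal_cells \<Delta>. aff_dim C = aff_dim D)"

definition cross_polytopal_complex :: "'a::euclidean_space set set \<Rightarrow> bool" where
  "cross_polytopal_complex \<Delta> \<longleftrightarrow>
     polytopal_complex \<Delta> \<and> pure_complex \<Delta> \<and>
     (\<forall>C\<in>maximal_cells \<Delta>. aff_dim C = int DIM('a) \<and> cross_polytope C)"

definition cross_polytopal_subdivision ::
  "'a::euclidean_space set set \<Rightarrow> 'a set \<Rightarrow> bool" where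
  "cross_polytopal_subdivision \<Delta> S \<longleftrightarrow> cross_polytopal_complex \<Delta> \<and> \<Union>\<Delta> = S"

definition complex_boundary :: "'a::euclidean_space set set \<Rightarrow> 'a set set" where
  "complex_boundary \<Delta> =
     {F. \<exists>G\<in>\<Delta>. aff_dim G = int DIM('a) - 1 \<and>
           (\<exists>!C. C \<in> maximal_cells \<Delta> \<and> G face_of C) \<and> F face_of G}"

text \<open>Only meaningful when \<open>\<Delta>\<close> is a cross-polytopal subdivision of the simplicial polytope \<open>P\<close>.\<close>

definition proper_subdivision :: "'a::euclidean_space set set \<Rightarrow> 'a set \<Rightarrow> bool" where
  "proper_subdivision \<Delta> P \<longleftrightarrow> complex_boundary \<Delta> \<simeq>\<^sub>c boundary_complex P"

definition num_cells :: "nat \<Rightarrow> 'a::euclidean_space set set \<Rightarrow> nat" where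
  "num_cells i \<Delta> = card {C\<in>\<Delta>. aff_dim C = int i}"

end

theory Submission
  imports Defs
begin

text \<open>
  The boundary of the 24-cell consists of 24 octahedra, any two of them meeting in a common face.
  Viewed through one of them, the other 23 form a subdivision of an octahedron (a Schlegel diagram of
  the 24-cell) whose boundary is the boundary of the octahedron looked through.  Each cell is
  simplicial, so the conditions that make such a picture a geometric subdivision - every cell
  strictly convex, neighbouring cells on opposite sides of the common triangle - are open in the
  positions of the vertices, and there is room to deform it.  The point is that the outer
  octahedron can be deformed into a tetrahedron: if the two ends of one of its diagonals move to
  the midpoints of two opposite edges of the tetrahedron spanned by the other four vertices, then
  its eight triangles become the eight halves of the four faces of this tetrahedron.  For
  the tetrahedron with vertices \<open>(\<plusminus>5,0,5), (0,\<plusminus>5,-5)\<close>, the eighteen inner vertices can be chosen with small integer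
  coordinates and invariant under the eight symmetries of the tetrahedron that preserve this pair
  of edges.  The boundary of the resulting complex is an octahedron with six vertices, while the
  tetrahedron has four, so the subdivision is not proper.

  That these 23 vertex sets describe a subdivision is reduced to finitely many integer
  inequalities.  First, six points with three marked diagonals span an octahedron as soon as
  each of the eight triangles has a supporting plane and each diagonal runs through the inside,
  which a positive affine dependence witnesses (\<open>cross_polytope_vertices\<close>).  Secondly, two
  cells meet face to face if some plane separates them and touches either of them exactly in the
  common vertices.  Thirdly, the cells cover the tetrahedron because every triangle lies in the
  boundary of the tetrahedron or in a second cell: a segment that starts inside a cell
  and avoids all edges can leave the union of the cells only through the boundary of the
  tetrahedron (\<open>interior_S_covered\<close>).  The locale \<open>octahedral_dissection\<close> collects these conditions
  and derives the complex and its boundary from them.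

  All conditions concern signs of affine functions at integer points.  They are
  checked in the coordinates above and hold for every tetrahedron after an affine change of
  coordinates, which turns affine functions into affine functions (\<open>tetrahedron_coordinates\<close>).
\<close>

section \<open>Combinatorial equivalence\<close>

lemma comb_equiv_image:
  assumes "\<And>F G. F \<in> A \<Longrightarrow> G \<in> A \<Longrightarrow> f F \<subseteq> f G \<longleftrightarrow> F \<subseteq> G"
  shows "A \<simeq>\<^sub>c f ` A"
  unfolding comb_equiv_def
proof (intro exI[of _ f] conjI ballI)
  show "bij_betw f A (f ` A)"
    unfolding bij_betw_def inj_on_def using assms by (metis order_refl subset_antisym)
qed (use assms in blast)

lemma comb_equiv_sym:
  assumes "A \<simeq>\<^sub>c B"
  shows "B \<simeq>\<^sub>c A"
proof -
  obtain f where f: "bij_betw f A B" "\<forall>F\<in>A. \<forall>G\<in>A. F \<subseteq> G \<longleftrightarrow> f F \<subseteq> f G"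
    using assms unfolding comb_equiv_def by (elim exE conjE)
  have "\<And>F. F \<in> B \<Longrightarrow> inv_into A f F \<in> A \<and> f (inv_into A f F) = F"
    using f(1) by (auto simp: bij_betw_def inv_into_into f_inv_into_f)
  then show ?thesis
    unfolding comb_equiv_def using f(2) bij_betw_inv_into[OF f(1)]
    by (intro exI[of _ "inv_into A f"]) auto
qed

lemma comb_equiv_trans:
  assumes "A \<simeq>\<^sub>c B" "B \<simeq>\<^sub>c C"
  shows "A \<simeq>\<^sub>c C"
proof -
  obtain f where f: "bij_betw f A B" "\<forall>F\<in>A. \<forall>G\<in>A. F \<subseteq> G \<longleftrightarrow> f F \<subseteq> f G"
    using assms(1) unfolding comb_equiv_def by (elim exE conjE)
  obtain g where g: "bij_betw g B C" "\<forall>F\<in>B. \<forall>G\<in>B. F \<subseteq> G \<longleftrightarrow> g F \<subseteq> g G"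
    using assms(2) unfolding comb_equiv_def by (elim exE conjE)
  have "f F \<in> B" if "F \<in> A" for F using f(1) that by (auto simp: bij_betw_def)
  then show ?thesis
    unfolding comb_equiv_def using f(2) g(2) bij_betw_trans[OF f(1) g(1)]
    by (intro exI[of _ "g \<circ> f"]) auto
qed

section \<open>Faces of the convex hull of a finite set\<close>

text \<open>
  Faces of a polytope are thus determined by the vertices they contain, which makes questions
  about the face lattice finite.
\<close>

lemma face_of_hull_eq:
  fixes V :: "'a::euclidean_space set"
  assumes "finite V" "F face_of convex hull V"
  shows "F = convex hull (V \<inter> F)"
proof -
  obtain W where "W \<subseteq> V" "F = convex hull W"
    using face_of_convex_hull_subset[OF finite_imp_compact[OF assms(1)] assms(2)] by blast
  then have "W \<subseteq> V \<inter> F" by (simp add: hull_subset)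
  with \<open>F = _\<close> have "F \<subseteq> convex hull (V \<inter> F)" by (simp add: hull_mono)
  moreover have "convex hull (V \<inter> F) \<subseteq> F"
    using face_of_imp_convex[OF assms(2)] by (simp add: subset_hull)
  ultimately show ?thesis by blast
qed

lemma hull_ge:
  fixes a :: "'a::euclidean_space"
  assumes "\<And>v. v \<in> V \<Longrightarrow> b \<le> a \<bullet> v" "x \<in> convex hull V"
  shows "b \<le> a \<bullet> x"
  using hull_minimal[of V "{x. a \<bullet> x \<ge> b}" convex] assms convex_halfspace_ge[of b a] by auto

lemma supporting_face:
  fixes a :: "'a::euclidean_space"
  assumes "finite V" and ge: "\<And>v. v \<in> V \<Longrightarrow> b \<le> a \<bullet> v"
  shows "convex hull V \<inter> {x. a \<bullet> x = b} = convex hull {v \<in> V. a \<bullet> v = b}"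
    and "convex hull {v \<in> V. a \<bullet> v = b} face_of convex hull V"
proof -
  let ?F = "convex hull V \<inter> {x. a \<bullet> x = b}"
  have F: "?F face_of convex hull V"
    by (rule face_of_Int_supporting_hyperplane_ge) (use hull_ge[OF ge] in auto)
  have "V \<inter> ?F = {v \<in> V. a \<bullet> v = b}" using hull_subset[of V convex] by auto
  then show *: "?F = convex hull {v \<in> V. a \<bullet> v = b}"
    using face_of_hull_eq[OF assms(1) F] by simp
  show "convex hull {v \<in> V. a \<bullet> v = b} face_of convex hull V"
    using F unfolding * .
qed

section \<open>The combinatorics of the cross-polytope\<close>

text \<open>
  The vertices \<open>\<plusminus>e\<^sub>i\<close> of the cross-polytope are indexed by \<open>(i, s)\<close> with a sign \<open>s\<close>.  Its
  proper faces are spanned by exactly the vertex sets without a pair of antipodes; the maximal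
  ones are the vertex sets of the orthants.
\<close>

definition antipode_free :: "('i \<times> bool) set \<Rightarrow> bool" where
  "antipode_free J \<longleftrightarrow> (\<forall>i. \<not> ((i, True) \<in> J \<and> (i, False) \<in> J))"

definition orthant :: "('i \<Rightarrow> bool) \<Rightarrow> ('i \<times> bool) set" where
  "orthant \<sigma> = range (\<lambda>i. (i, \<sigma> i))"

lemma mem_orthant [simp]: "(i, s) \<in> orthant \<sigma> \<longleftrightarrow> s = \<sigma> i"
  by (auto simp: orthant_def)

lemma card_orthant: "card (orthant (\<sigma> :: 'i::finite \<Rightarrow> bool)) = CARD('i)"
  by (auto simp: orthant_def card_image inj_on_def)

lemma antipode_free_orthant: "antipode_free (orthant \<sigma>)"
  by (simp add: antipode_free_def) 

lemma antipode_free_subset: "antipode_free J \<Longrightarrow> K \<subseteq> J \<Longrightarrow> antipode_free K"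
  by (auto simp: antipode_free_def)

lemma antipode_free_subset_orthant:
  assumes "antipode_free J" "k \<notin> J"
  obtains \<sigma> where "J \<subseteq> orthant \<sigma>" "k \<notin> orthant \<sigma>"
proof -
  obtain i s where k: "k = (i, s)" by (cases k)
  let ?\<sigma> = "\<lambda>j. if (j, True) \<in> J then True else if (j, False) \<in> J then False else \<not> s"
  have "J \<subseteq> orthant ?\<sigma>"
  proof
    fix x assume "x \<in> J"
    then show "x \<in> orthant ?\<sigma>"
      using assms(1) by (cases x; cases "snd x") (auto simp: antipode_free_def)
  qed
  moreover have "k \<notin> orthant ?\<sigma>" using assms(2) unfolding k by (cases s) auto
  ultimately show thesis by (rule that)
qed

lemma antipode_free_imp_subset_orthant:
  assumes "antipode_free J"
  obtains \<sigma> where "J \<subseteq> orthant \<sigma>"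
proof -
  have "J \<noteq> UNIV" using assms by (auto simp: antipode_free_def)
  then obtain k where "k \<notin> J" by auto
  then show thesis using antipode_free_subset_orthant[OF assms] that by metis
qed

lemma antipode_free_card_eq:
  fixes J :: "('i::finite \<times> bool) set"
  assumes "antipode_free J" "CARD('i) \<le> card J"
  obtains \<sigma> where "J = orthant \<sigma>"
proof -
  obtain \<sigma> where "J \<subseteq> orthant \<sigma>" using antipode_free_imp_subset_orthant[OF assms(1)] .
  then have "J = orthant \<sigma>" using assms(2) by (intro card_seteq) (auto simp: card_orthant)
  then show thesis by (rule that)
qed

lemma antipode_free_superset_orthant:
  assumes "antipode_free J" "orthant \<sigma> \<subseteq> J"
  shows "J = orthant \<sigma>"
proof (rule equalityI[OF _ assms(2)], rule subsetI)
  fix k assume k: "k \<in> J"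
  obtain i s where [simp]: "k = (i, s)" by (cases k)
  have "(i, \<sigma> i) \<in> J" using assms(2) by auto
  then show "k \<in> orthant \<sigma>" using k assms(1) by (cases s; cases "\<sigma> i") (auto simp: antipode_free_def)
qed

text \<open>
  Each axis contributes its positive end, its negative end, or neither.
\<close>

lemma card_antipode_free: "card {J :: ('i::finite \<times> bool) set. antipode_free J} = 3 ^ CARD('i)"
proof -
  let ?f = "\<lambda>g :: 'i \<Rightarrow> bool option. {(i, s). g i = Some s}"
  have "bij_betw ?f UNIV {J. antipode_free J}"
    unfolding bij_betw_def
  proof (intro conjI equalityI subsetI)
    show "inj ?f"
    proof (rule injI)
      fix g h assume eq: "?f g = ?f h"
      have "g i = Some s \<longleftrightarrow> h i = Some s" for i s using eq by auto
      then show "g = h" by (metis ext not_Some_eq)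
    qed
  next
    fix J assume J: "J \<in> {J :: ('i \<times> bool) set. antipode_free J}"
    define g where
      "g i = (if (i, True) \<in> J then Some True else if (i, False) \<in> J then Some False else None)" for i
    have "(i, s) \<in> J \<longleftrightarrow> g i = Some s" for i s
      using J by (cases s) (auto simp: antipode_free_def g_def)
    then have "J = ?f g" by auto
    then show "J \<in> range ?f" by blast
  qed (auto simp: antipode_free_def)
  then have "card {J :: ('i \<times> bool) set. antipode_free J} = CARD('i \<Rightarrow> bool option)"
    by (simp add: bij_betw_same_card)
  then show ?thesis by (simp add: card_fun)
qed

lemma sum_signed: "(\<Sum>k\<in>UNIV. f k) = (\<Sum>i\<in>UNIV. f (i, True) + f (i, False))"
proof -
  have "(\<Sum>k\<in>UNIV. f k) = (\<Sum>i\<in>UNIV. \<Sum>s\<in>UNIV. f (i, s))"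
    by (simp add: sum.cartesian_product)
  then show ?thesis by (simp add: UNIV_bool add.commute)
qed

section \<open>Recognising a cross-polytope from its vertices\<close>

definition supports :: "('i \<times> bool \<Rightarrow> 'a::euclidean_space) \<Rightarrow> ('i \<Rightarrow> bool) \<Rightarrow> 'a \<Rightarrow> real \<Rightarrow> bool" where
  "supports q \<sigma> a b \<longleftrightarrow> (\<forall>i. a \<bullet> q (i, \<sigma> i) = b \<and> b < a \<bullet> q (i, \<not> \<sigma> i))"

lemma supports_iff:
  "supports q \<sigma> a b \<longleftrightarrow> (\<forall>k. b \<le> a \<bullet> q k \<and> (a \<bullet> q k = b \<longleftrightarrow> k \<in> orthant \<sigma>))"
proof
  assume s: "supports q \<sigma> a b"
  show "\<forall>k. b \<le> a \<bullet> q k \<and> (a \<bullet> q k = b \<longleftrightarrow> k \<in> orthant \<sigma>)"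
  proof
    fix k :: "'a \<times> bool"
    obtain i t where k: "k = (i, t)" by (cases k)
    have "t = \<sigma> i \<or> t = (\<not> \<sigma> i)" by auto
    then show "b \<le> a \<bullet> q k \<and> (a \<bullet> q k = b \<longleftrightarrow> k \<in> orthant \<sigma>)"
      using s unfolding supports_def k by (auto dest: spec[of _ i])
  qed
next
  assume r: "\<forall>k. b \<le> a \<bullet> q k \<and> (a \<bullet> q k = b \<longleftrightarrow> k \<in> orthant \<sigma>)"
  show "supports q \<sigma> a b"
    unfolding supports_def
  proof
    fix i
    show "a \<bullet> q (i, \<sigma> i) = b \<and> b < a \<bullet> q (i, \<not> \<sigma> i)"
      using r[rule_format, of "(i, \<sigma> i)"] r[rule_format, of "(i, \<not> \<sigma> i)"] by auto
  qed
qed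

text \<open>
  An affine dependence of the vertices whose coefficients are positive off the diagonal \<open>i\<close> says
  that the line through this diagonal meets the relative interior of the convex hull of the other
  vertices.
\<close>

definition balanced_diagonal :: "('i::finite \<times> bool \<Rightarrow> 'a::euclidean_space) \<Rightarrow> 'i \<Rightarrow> bool" where
  "balanced_diagonal q i \<longleftrightarrow>
     (\<exists>w. (\<forall>k. fst k \<noteq> i \<longrightarrow> 0 < w k) \<and>
          (\<Sum>k\<in>UNIV. w k *\<^sub>R q k) = 0 \<and> (\<Sum>k\<in>UNIV. w k) = (0::real))"

text \<open>
  Pairing the dependence with the affine function \<open>a \<bullet> x - b\<close> gives a vanishing sum without
  negative terms.
\<close>

lemma balanced_diagonal_in_hyperplane:
  assumes bal: "balanced_diagonal q i" and ge: "\<And>k. b \<le> a \<bullet> q k"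
    and d: "a \<bullet> q (i, True) = b" "a \<bullet> q (i, False) = b"
  shows "a \<bullet> q k = b"
proof -
  obtain w where w: "\<And>k. fst k \<noteq> i \<Longrightarrow> 0 < w k" "(\<Sum>k\<in>UNIV. w k *\<^sub>R q k) = 0"
    "(\<Sum>k\<in>UNIV. w k) = (0::real)"
    using bal unfolding balanced_diagonal_def by blast
  have "(\<Sum>k\<in>UNIV. w k * (a \<bullet> q k - b)) = a \<bullet> (\<Sum>k\<in>UNIV. w k *\<^sub>R q k) - b * (\<Sum>k\<in>UNIV. w k)"
    by (simp add: inner_sum_right sum_distrib_left algebra_simps sum_subtractf)
  then have s0: "(\<Sum>k\<in>UNIV. w k * (a \<bullet> q k - b)) = 0" using w by simp
  have diag: "a \<bullet> q k = b" if "fst k = i" for k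
    using that d by (cases k; cases "snd k") auto
  have nn: "0 \<le> w k * (a \<bullet> q k - b)" for k
    using diag w(1)[of k] ge[of k] by (cases "fst k = i") auto
  have "w k * (a \<bullet> q k - b) = 0"
    using sum_nonneg_eq_0_iff[of UNIV "\<lambda>k. w k * (a \<bullet> q k - b)"] s0 nn finite by (metis UNIV_I)
  then show ?thesis
    using diag w(1)[of k] by (metis eq_iff_diff_eq_0 less_irrefl mult_eq_0_iff)
qed

text \<open>
  A certificate that the points \<open>q k\<close> are the vertices of a cross-polytope of full dimension.  The
  supporting hyperplanes show that all expected faces occur, and the balanced diagonals that
  there are no others.
\<close>

locale cross_polytope_vertices =
  fixes q :: "'i::finite \<times> bool \<Rightarrow> 'a::euclidean_space"
  assumes facet: "\<And>\<sigma>. \<exists>a b. supports q \<sigma> a b"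
    and diagonal: "\<And>i. balanced_diagonal q i"
    and dim: "CARD('i) = DIM('a)"
begin

abbreviation P :: "'a set" where "P \<equiv> convex hull (range q)"

lemma polytope_P: "polytope P"
  unfolding polytope_def by (rule exI[of _ "range q"]) simp

lemma facet_hyperplane:
  assumes "supports q \<sigma> a b"
  shows "P \<inter> {x. a \<bullet> x = b} = convex hull (q ` orthant \<sigma>)"
    and "convex hull (q ` orthant \<sigma>) face_of P"
    and "x \<in> P \<Longrightarrow> b \<le> a \<bullet> x"
proof -
  have ge: "\<And>v. v \<in> range q \<Longrightarrow> b \<le> a \<bullet> v" and eq: "{v \<in> range q. a \<bullet> v = b} = q ` orthant \<sigma>"
    using assms unfolding supports_iff by (blast, blast)
  show "P \<inter> {x. a \<bullet> x = b} = convex hull (q ` orthant \<sigma>)"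
    "convex hull (q ` orthant \<sigma>) face_of P"
    using supporting_face[of "range q" b a] ge by (simp_all add: eq)
  show "x \<in> P \<Longrightarrow> b \<le> a \<bullet> x" using hull_ge[OF ge] .
qed

lemma vertex_mem_facet: "q k \<in> convex hull (q ` orthant \<sigma>) \<longleftrightarrow> k \<in> orthant \<sigma>"
proof -
  obtain a b where ab: "supports q \<sigma> a b" using facet by blast
  have "q k \<in> P" by (simp add: hull_inc)
  then have "q k \<in> convex hull (q ` orthant \<sigma>) \<longleftrightarrow> a \<bullet> q k = b"
    using facet_hyperplane(1)[OF ab] by auto
  then show ?thesis using ab unfolding supports_iff by blast
qed

text \<open>
  The face is the intersection of the facets that contain its vertices: for every vertex
  outside an antipode-free set there is an orthant that contains the set and misses this vertex.
\<close>

lemma face_of_antipode_free: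
  assumes "antipode_free J"
  shows "convex hull (q ` J) face_of P" and "q k \<in> convex hull (q ` J) \<longleftrightarrow> k \<in> J"
proof -
  define F where "F = \<Inter>{convex hull (q ` orthant \<sigma>) | \<sigma>. J \<subseteq> orthant \<sigma>}"
  obtain \<sigma>0 where "J \<subseteq> orthant \<sigma>0" using antipode_free_imp_subset_orthant[OF assms] .
  then have ne: "{convex hull (q ` orthant \<sigma>) | \<sigma>. J \<subseteq> orthant \<sigma>} \<noteq> {}" by auto
  have F: "F face_of P"
    unfolding F_def
  proof (rule face_of_Inter[OF ne])
    fix T assume "T \<in> {convex hull (q ` orthant \<sigma>) | \<sigma>. J \<subseteq> orthant \<sigma>}"
    then show "T face_of P" using facet facet_hyperplane(2) by blast
  qed
  have qF: "q k \<in> F \<longleftrightarrow> k \<in> J" for k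
  proof
    assume "q k \<in> F"
    then have "J \<subseteq> orthant \<sigma> \<Longrightarrow> k \<in> orthant \<sigma>" for \<sigma>
      unfolding F_def using vertex_mem_facet by blast
    then show "k \<in> J" using antipode_free_subset_orthant[OF assms] by metis
  next
    assume "k \<in> J" then show "q k \<in> F" unfolding F_def using vertex_mem_facet by blast
  qed
  have "range q \<inter> F = q ` J" using qF by auto
  then have FJ: "F = convex hull (q ` J)" using face_of_hull_eq[OF _ F] by simp
  show "convex hull (q ` J) face_of P" "q k \<in> convex hull (q ` J) \<longleftrightarrow> k \<in> J"
    using F qF unfolding FJ by auto
qed

lemma inj_q: "inj q"
proof (rule injI)
  fix k l assume eq: "q k = q l"
  have "antipode_free {k}" by (auto simp: antipode_free_def)
  from face_of_antipode_free(2)[OF this, of k] face_of_antipode_free(2)[OF this, of l]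
  show "k = l" using eq by simp
qed

text \<open>
  Every face of a polytope is exposed, so the dependence along the diagonal applies to an affine
  function that cuts out the face.
\<close>

lemma face_containing_diagonal:
  assumes F: "F face_of P" and d: "q (i, True) \<in> F" "q (i, False) \<in> F"
  shows "F = P"
proof (cases "F = {}")
  case True then show ?thesis using d by auto
next
  case False
  have "F exposed_face_of P"
    using F exposed_face_of_polyhedron[OF polytope_imp_polyhedron[OF polytope_P]] by blast
  then obtain a b where ab: "P \<subseteq> {x. a \<bullet> x \<le> b}" "F = P \<inter> {x. a \<bullet> x = b}"
    unfolding exposed_face_of_def by blast
  have "- a \<bullet> q k = - b" for k
    by (rule balanced_diagonal_in_hyperplane[OF diagonal])
       (use ab d hull_inc[of "q _" "range q"] in auto)
  then have "range q \<subseteq> F" using ab(2) by (auto simp: hull_inc)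
  then have "P \<subseteq> F" using face_of_imp_convex[OF F] by (simp add: subset_hull)
  then show ?thesis using ab(2) by blast
qed

lemma proper_face:
  assumes "F face_of P" "F \<noteq> P"
  obtains J where "antipode_free J" "F = convex hull (q ` J)"
proof -
  let ?J = "{k. q k \<in> F}"
  have "antipode_free ?J" using face_containing_diagonal[OF assms(1)] assms(2)
    by (auto simp: antipode_free_def)
  moreover have "range q \<inter> F = q ` ?J" by auto
  then have "F = convex hull (q ` ?J)" using face_of_hull_eq[OF _ assms(1)] by simp
  ultimately show thesis by (rule that)
qed

lemma P_not_antipode_free: "antipode_free J \<Longrightarrow> convex hull (q ` J) \<noteq> P"
proof
  assume J: "antipode_free J" and eq: "convex hull (q ` J) = P"
  have "k \<in> J" for k using face_of_antipode_free(2)[OF J, of k] eq by (simp add: hull_inc)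
  then show False using J by (auto simp: antipode_free_def)
qed

lemma hull_antipode_free_subset:
  assumes "antipode_free K"
  shows "convex hull (q ` J) \<subseteq> convex hull (q ` K) \<longleftrightarrow> J \<subseteq> K"
proof
  assume "convex hull (q ` J) \<subseteq> convex hull (q ` K)"
  then have "q k \<in> convex hull (q ` K)" if "k \<in> J" for k using that by (auto simp: hull_inc)
  then show "J \<subseteq> K" using face_of_antipode_free(2)[OF assms] by blast
qed (simp add: hull_mono image_mono)

text \<open>
  Adding the vertices one at a time gives a strictly increasing chain of faces, and the dimension
  grows at every step.  This replaces any computation of determinants.
\<close>

lemma aff_dim_lower:
  assumes "antipode_free J"
  shows "int (card J) - 1 \<le> aff_dim (convex hull (q ` J))"
proof -
  have "finite J" by simp
  then show ?thesis using assms
  proof (induction J rule: finite_induct)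
    case (insert k J)
    have J: "antipode_free J" using insert.prems by (rule antipode_free_subset) auto
    have "convex hull (q ` J) face_of convex hull (q ` insert k J)"
      using face_of_antipode_free(1)[OF J] face_of_antipode_free(1)[OF insert.prems]
      using face_of_face[OF face_of_antipode_free(1)[OF insert.prems]] hull_mono[of "q ` J" "q ` insert k J"]
      by blast
    moreover have "convex hull (q ` J) \<noteq> convex hull (q ` insert k J)"
      using hull_antipode_free_subset[OF J, of "insert k J"] insert.hyps by auto
    ultimately have "aff_dim (convex hull (q ` J)) < aff_dim (convex hull (q ` insert k J))"
      using face_of_aff_dim_lt convex_convex_hull by blast
    then show ?case using insert.IH[OF J] insert.hyps by simp
  qed simp
qed

lemma aff_dim_face:
  assumes "antipode_free J"
  shows "aff_dim (convex hull (q ` J)) = int (card J) - 1"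
proof -
  have "aff_dim (q ` J) \<le> int (card (q ` J)) - 1" by (rule aff_dim_le_card) simp
  also have "card (q ` J) = card J" using inj_q by (simp add: card_image inj_on_subset)
  finally show ?thesis using aff_dim_lower[OF assms] by (simp add: aff_dim_convex_hull)
qed

lemma aff_dim_P: "aff_dim P = DIM('a)"
proof -
  let ?F = "convex hull (q ` orthant (\<lambda>_. True))"
  have "aff_dim ?F < aff_dim P"
    by (intro face_of_aff_dim_lt face_of_antipode_free P_not_antipode_free antipode_free_orthant)
       simp
  then have "int DIM('a) \<le> aff_dim P"
    by (simp add: aff_dim_face antipode_free_orthant card_orthant dim)
  then show ?thesis using aff_dim_le_DIM[of P] by simp
qed

lemma interior_P: "interior P \<noteq> {}"
  using aff_dim_P interior_rel_interior_gen[of P] rel_interior_eq_empty[of P] aff_dim_empty[of P]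
  by auto

lemma facet_face:
  assumes "F face_of P" "aff_dim F = int DIM('a) - 1"
  obtains \<sigma> where "F = convex hull (q ` orthant \<sigma>)"
proof -
  have "F \<noteq> P" using assms(2) aff_dim_P by auto
  then obtain J where J: "antipode_free J" "F = convex hull (q ` J)"
    using proper_face[OF assms(1)] by blast
  then have "CARD('i) \<le> card J" using aff_dim_face[OF J(1)] assms(2) dim by simp
  then show thesis using antipode_free_card_eq[OF J(1)] J(2) that by metis
qed

lemma interior_imp_gt:
  assumes "supports q \<sigma> a b" "p \<in> interior P"
  shows "b < a \<bullet> p"
proof -
  have "a \<noteq> 0" using assms(1) unfolding supports_def by auto
  then have "interior {x. b \<le> a \<bullet> x} = {x. b < a \<bullet> x}" by simp
  moreover have "P \<subseteq> {x. b \<le> a \<bullet> x}" using facet_hyperplane(3)[OF assms(1)] by blast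
  ultimately show ?thesis using assms(2) interior_mono by blast
qed

text \<open>
  If \<open>z\<close> satisfies all facet inequalities but lies outside, then the segment from an interior
  point to \<open>z\<close> crosses the boundary before it reaches \<open>z\<close>.  The crossing point lies on some
  facet, but the inequality of this facet is strict at all points of the segment before \<open>z\<close>.
  The supporting hyperplanes are arbitrary here, which allows one of them to be exchanged later.
\<close>

lemma halfspace_representation:
  assumes sup: "\<And>\<sigma>. supports q \<sigma> (a \<sigma>) (b \<sigma>)"
  shows "z \<in> P \<longleftrightarrow> (\<forall>\<sigma>. b \<sigma> \<le> a \<sigma> \<bullet> z)"
proof
  assume "z \<in> P" then show "\<forall>\<sigma>. b \<sigma> \<le> a \<sigma> \<bullet> z" using facet_hyperplane(3)[OF sup] by blast
next
  assume z: "\<forall>\<sigma>. b \<sigma> \<le> a \<sigma> \<bullet> z"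
  show "z \<in> P"
  proof (rule ccontr)
    assume "z \<notin> P"
    obtain p where p: "p \<in> interior P" using interior_P by blast
    then have "closed_segment p z \<inter> P \<noteq> {}" "closed_segment p z - P \<noteq> {}"
      using \<open>z \<notin> P\<close> interior_subset by fastforce+
    then obtain y where y: "y \<in> closed_segment p z" "y \<in> frontier P"
      using connected_Int_frontier[OF connected_segment(1)] by blast
    have "closed P" using polytope_P polytope_imp_closed by blast
    then have "y \<in> P" using y(2) frontier_subset_eq by blast
    have "y \<noteq> z" using \<open>y \<in> P\<close> \<open>z \<notin> P\<close> by blast
    obtain t where t: "0 \<le> t" "t \<le> 1" "y = (1 - t) *\<^sub>R p + t *\<^sub>R z"
      using y(1) unfolding closed_segment_def by blast
    have "t < 1" using t \<open>y \<noteq> z\<close> by (cases "t = 1") auto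
    have "y \<in> rel_frontier P"
      using y(2) aff_dim_P rel_frontier_nonempty_interior[of P] interior_P by auto
    then obtain F where F: "F face_of P" "F \<noteq> P" "y \<in> F"
      using rel_frontier_of_polyhedron_alt[OF polytope_imp_polyhedron[OF polytope_P]] by auto
    then obtain J where J: "antipode_free J" "F = convex hull (q ` J)" using proper_face by metis
    obtain \<sigma> where "J \<subseteq> orthant \<sigma>" using antipode_free_imp_subset_orthant[OF J(1)] .
    then have "y \<in> convex hull (q ` orthant \<sigma>)"
      using F(3) J(2) hull_mono[of "q ` J" "q ` orthant \<sigma>"] by blast
    then have "a \<sigma> \<bullet> y = b \<sigma>" using facet_hyperplane(1)[OF sup] by blast
    moreover have "b \<sigma> < (1 - t) * (a \<sigma> \<bullet> p) + t * (a \<sigma> \<bullet> z)"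
    proof -
      have "(1 - t) * b \<sigma> < (1 - t) * (a \<sigma> \<bullet> p)"
        using \<open>t < 1\<close> interior_imp_gt[OF sup p, of \<sigma>] by simp
      moreover have "t * b \<sigma> \<le> t * (a \<sigma> \<bullet> z)" using z t(1) by (simp add: mult_left_mono)
      ultimately show ?thesis by (simp add: algebra_simps)
    qed
    ultimately show False using t(3) by (simp add: inner_add_right)
  qed
qed

lemma boundary_complex_equiv: "{J :: ('i \<times> bool) set. antipode_free J} \<simeq>\<^sub>c boundary_complex P"
proof -
  have eq: "boundary_complex P = (\<lambda>J. convex hull (q ` J)) ` {J. antipode_free J}"
    unfolding boundary_complex_def
    using proper_face face_of_antipode_free(1) P_not_antipode_free by blast
  show ?thesis unfolding eq
    by (rule comb_equiv_image) (simp add: hull_antipode_free_subset)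
qed

lemma face_lattice_equiv: "insert UNIV {J :: ('i \<times> bool) set. antipode_free J} \<simeq>\<^sub>c face_lattice P"
proof -
  let ?f = "\<lambda>J. convex hull (q ` J)" and ?A = "insert UNIV {J. antipode_free J}"
  have "face_lattice P = ?f ` ?A"
    unfolding face_lattice_def
    using proper_face face_of_antipode_free(1) face_of_refl[OF convex_convex_hull[of "range q"]]
    by blast
  moreover have "?f J \<subseteq> ?f K \<longleftrightarrow> J \<subseteq> K" if JK: "J \<in> ?A" "K \<in> ?A" for J K
  proof (cases "K = UNIV")
    case True
    then show ?thesis by (simp add: hull_mono image_mono)
  next
    case False
    then show ?thesis using JK hull_antipode_free_subset by blast
  qed
  ultimately show ?thesis using comb_equiv_image[of ?A ?f] by simp
qed

end

definition unit_vertex :: "'n::finite \<times> bool \<Rightarrow> real ^ 'n" where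
  "unit_vertex k = (if snd k then axis (fst k) 1 else - axis (fst k) 1)"

text \<open>
  The weight \<open>1 - n\<close> at both ends of the diagonal \<open>i\<close> compensates the weight \<open>1\<close> at the other
  vertices.
\<close>

lemma cross_polytope_vertices_unit: "cross_polytope_vertices (unit_vertex :: 'n::finite \<times> bool \<Rightarrow> real ^ 'n)"
proof
  fix \<sigma> :: "'n \<Rightarrow> bool"
  have "supports unit_vertex \<sigma> (\<chi> i. if \<sigma> i then -1 else 1) (-1)"
    unfolding supports_def unit_vertex_def by (simp add: inner_axis)
  then show "\<exists>a b. supports unit_vertex \<sigma> (a :: real ^ 'n) b" by blast
next
  fix i :: 'n
  let ?w = "\<lambda>k. 1 - (if fst k = i then real CARD('n) else 0)"
  show "balanced_diagonal (unit_vertex :: 'n \<times> bool \<Rightarrow> real ^ 'n) i"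
    unfolding balanced_diagonal_def
    by (rule exI[of _ ?w])
       (simp add: sum_signed unit_vertex_def sum_subtractf sum.delta flip: sum_distrib_left mult_2)
qed simp

lemma regular_cross_polytope_eq:
  "(regular_cross_polytope :: (real ^ 'n) set) = convex hull (range unit_vertex)"
proof -
  have "range unit_vertex = (Basis \<union> uminus ` Basis :: (real ^ 'n) set)"
  proof (intro equalityI subsetI)
    fix x :: "real ^ 'n" assume "x \<in> range unit_vertex"
    then show "x \<in> Basis \<union> uminus ` Basis"
      by (auto simp: unit_vertex_def Basis_vec_def split: if_splits)
  next
    fix x :: "real ^ 'n" assume "x \<in> Basis \<union> uminus ` Basis"
    then obtain i where "x = unit_vertex (i, True) \<or> x = unit_vertex (i, False)"
      by (auto simp: unit_vertex_def Basis_vec_def)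
    then show "x \<in> range unit_vertex" by blast
  qed
  then show ?thesis by (simp add: regular_cross_polytope_def)
qed

section \<open>Dissections into cross-polytopes\<close>

lemma negligible_UN:
  assumes "finite I" "\<And>i. i \<in> I \<Longrightarrow> negligible (X i)"
  shows "negligible (\<Union>i\<in>I. X i)"
  using assms by (intro negligible_Union) auto

text \<open>
  The cells are indexed by \<open>K\<close>, with vertices \<open>q c\<close>; the points \<open>r\<close> are the vertices of a
  subdivision of the boundary of \<open>S\<close> that has the combinatorial type of a cross-polytope, although
  several of its facets may lie in one facet of \<open>S\<close>.  A facet of a cell is either shared with
  another cell or one of these boundary facets.
\<close>

locale octahedral_dissection =
  fixes K :: "'c set" and q :: "'c \<Rightarrow> 'i::finite \<times> bool \<Rightarrow> 'a::euclidean_space"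
    and r :: "'i \<times> bool \<Rightarrow> 'a" and S :: "'a set"
  assumes finite_K: "finite K" and K_nonempty: "K \<noteq> {}"
    and dim: "CARD('i) = DIM('a)"
    and convex_S: "convex S" and closed_S: "closed S"
    and cell_subset: "c \<in> K \<Longrightarrow> range (q c) \<subseteq> S"
    and diagonal: "c \<in> K \<Longrightarrow> balanced_diagonal (q c) i"
    and separation: "\<lbrakk>c \<in> K; d \<in> K; c \<noteq> d\<rbrakk> \<Longrightarrow>
      \<exists>a b. (\<forall>x\<in>range (q c). b < a \<bullet> x \<or> a \<bullet> x = b \<and> x \<in> range (q d)) \<and>
            (\<forall>x\<in>range (q d). a \<bullet> x < b \<or> a \<bullet> x = b \<and> x \<in> range (q c)) \<and>
            (\<exists>x\<in>range (q c). b < a \<bullet> x)"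
    and facet_cases: "c \<in> K \<Longrightarrow>
      (\<exists>d\<in>K. d \<noteq> c \<and> q c ` orthant \<sigma> \<subseteq> range (q d)) \<or>
      (\<exists>\<rho>. q c ` orthant \<sigma> = r ` orthant \<rho> \<and>
           (\<exists>a b. supports (q c) \<sigma> a b \<and> (\<forall>x\<in>S. b \<le> a \<bullet> x)))"
    and inj_r: "inj r"
    and boundary_facet: "\<exists>c\<in>K. \<exists>\<sigma>. q c ` orthant \<sigma> = r ` orthant \<rho> \<and>
      (\<forall>d\<in>K. r ` orthant \<rho> \<subseteq> range (q d) \<longrightarrow> d = c)"
begin

definition cell :: "'c \<Rightarrow> 'a set" where "cell c = convex hull (range (q c))"

definition subdivision :: "'a set set" where "subdivision = {F. \<exists>c\<in>K. F face_of cell c}"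

text \<open>
  A plane that separates \<open>c\<close> from \<open>d\<close> cannot contain a diagonal of \<open>c\<close>, since otherwise it would
  contain all of \<open>c\<close>.  Hence the common vertices span a proper face of \<open>c\<close>.
\<close>

lemma contact_set:
  assumes "c \<in> K" "d \<in> K" "c \<noteq> d"
  obtains a b where "\<And>k. b \<le> a \<bullet> q c k" "\<And>k. a \<bullet> q c k = b \<longleftrightarrow> q c k \<in> range (q d)"
    "\<And>k. a \<bullet> q d k \<le> b" "\<And>k. a \<bullet> q d k = b \<longleftrightarrow> q d k \<in> range (q c)"
    "antipode_free {k. q c k \<in> range (q d)}"
proof -
  obtain a b where ab: "\<forall>x\<in>range (q c). b < a \<bullet> x \<or> a \<bullet> x = b \<and> x \<in> range (q d)"
    "\<forall>x\<in>range (q d). a \<bullet> x < b \<or> a \<bullet> x = b \<and> x \<in> range (q c)"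
    "\<exists>x\<in>range (q c). b < a \<bullet> x"
    using separation[OF assms] by (elim exE conjE)
  have c: "b \<le> a \<bullet> q c k" "a \<bullet> q c k = b \<longleftrightarrow> q c k \<in> range (q d)" for k
    using bspec[OF ab(1) rangeI[of "q c" k]] bspec[OF ab(2), of "q c k"] by auto
  have d: "a \<bullet> q d k \<le> b" "a \<bullet> q d k = b \<longleftrightarrow> q d k \<in> range (q c)" for k
    using bspec[OF ab(2) rangeI[of "q d" k]] bspec[OF ab(1), of "q d k"] by auto
  have "antipode_free {k. q c k \<in> range (q d)}"
    unfolding antipode_free_def
  proof (intro allI notI, elim conjE, unfold mem_Collect_eq)
    fix i assume "q c (i, True) \<in> range (q d)" "q c (i, False) \<in> range (q d)"
    then have "a \<bullet> q c k = b" for k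
      using balanced_diagonal_in_hyperplane[OF diagonal[OF assms(1)] c(1)] c(2) by blast
    then show False using ab(3) by auto
  qed
  then show thesis by (rule that[OF c d])
qed

lemma cross_polytope_vertices_cell:
  assumes c: "c \<in> K"
  shows "cross_polytope_vertices (q c)"
proof
  fix \<sigma>
  show "\<exists>a b. supports (q c) \<sigma> a b"
    using facet_cases[OF c, of \<sigma>]
  proof
    assume "\<exists>d\<in>K. d \<noteq> c \<and> q c ` orthant \<sigma> \<subseteq> range (q d)"
    then obtain d where d: "d \<in> K" "c \<noteq> d" "q c ` orthant \<sigma> \<subseteq> range (q d)" by blast
    obtain a b where ab: "\<And>k. b \<le> a \<bullet> q c k" "\<And>k. a \<bullet> q c k = b \<longleftrightarrow> q c k \<in> range (q d)"
      "antipode_free {k. q c k \<in> range (q d)}"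
      using contact_set[OF c d(1,2)] by metis
    have "{k. q c k \<in> range (q d)} = orthant \<sigma>"
      using antipode_free_superset_orthant[OF ab(3)] d(3) by blast
    then have "supports (q c) \<sigma> a b" unfolding supports_iff using ab(1,2) by blast
    then show ?thesis by blast
  qed blast
qed (use c dim diagonal in auto)

text \<open>
  For two cells that share a facet the separating plane supports both, from opposite sides, and
  serves as the facet plane of either.
\<close>

lemma shared_facet:
  assumes c: "c \<in> K" "d \<in> K" "c \<noteq> d" and sub: "q c ` orthant \<sigma> \<subseteq> range (q d)"
  obtains a b \<tau> where "supports (q c) \<sigma> a b" "supports (q d) \<tau> (- a) (- b)"
    "q d ` orthant \<tau> = q c ` orthant \<sigma>"
proof -
  interpret C: cross_polytope_vertices "q c" using cross_polytope_vertices_cell c by blast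
  interpret D: cross_polytope_vertices "q d" using cross_polytope_vertices_cell c by blast
  obtain a b where ab: "\<And>k. b \<le> a \<bullet> q c k" "\<And>k. a \<bullet> q c k = b \<longleftrightarrow> q c k \<in> range (q d)"
    "\<And>k. a \<bullet> q d k \<le> b" "\<And>k. a \<bullet> q d k = b \<longleftrightarrow> q d k \<in> range (q c)"
    "antipode_free {k. q c k \<in> range (q d)}"
    using contact_set[OF c] by metis
  let ?J = "{k. q d k \<in> range (q c)}"
  have o: "{k. q c k \<in> range (q d)} = orthant \<sigma>"
    using antipode_free_superset_orthant[OF ab(5)] sub by blast
  have "q d ` ?J = range (q c) \<inter> range (q d)" "q c ` {k. q c k \<in> range (q d)} = range (q c) \<inter> range (q d)"
    unfolding vimage_def[symmetric] image_vimage_eq by (simp_all add: Int_commute)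
  then have J: "q d ` ?J = q c ` orthant \<sigma>" using o by simp
  have "antipode_free ?J" using contact_set[OF c(2,1)] c(3) by metis
  moreover have "card ?J = CARD('i)"
    using J card_image[OF inj_on_subset[OF D.inj_q]] card_image[OF inj_on_subset[OF C.inj_q]]
    by (metis card_orthant subset_UNIV)
  ultimately obtain \<tau> where \<tau>: "?J = orthant \<tau>" using antipode_free_card_eq by (metis order_refl)
  have "supports (q c) \<sigma> a b" unfolding supports_iff using ab(1,2) o by blast
  moreover have "k \<in> orthant \<tau> \<longleftrightarrow> q d k \<in> range (q c)" for k using \<tau> by blast
  then have "supports (q d) \<tau> (- a) (- b)"
    unfolding supports_iff using ab(3,4) by (simp del: split_paired_All)
  ultimately show thesis using that J \<tau> by metis
qed

lemma cell_Int:
  assumes "c \<in> K" "d \<in> K" "c \<noteq> d"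
  shows "cell c \<inter> cell d = convex hull (range (q c) \<inter> range (q d))"
    and "cell c \<inter> cell d face_of cell c"
proof -
  obtain a b where ab: "\<And>k. b \<le> a \<bullet> q c k" "\<And>k. a \<bullet> q c k = b \<longleftrightarrow> q c k \<in> range (q d)"
    "\<And>k. a \<bullet> q d k \<le> b"
    using contact_set[OF assms] by metis
  have eq: "{v \<in> range (q c). a \<bullet> v = b} = range (q c) \<inter> range (q d)" using ab(2) by blast
  have ge: "b \<le> a \<bullet> v" if "v \<in> range (q c)" for v using ab(1) that by blast
  have C: "cell c \<inter> {x. a \<bullet> x = b} = convex hull (range (q c) \<inter> range (q d))"
    "convex hull (range (q c) \<inter> range (q d)) face_of cell c"
    using supporting_face[of "range (q c)" b a, OF _ ge] by (simp_all add: eq cell_def)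
  have "convex hull (range (q c) \<inter> range (q d)) \<subseteq> cell d" unfolding cell_def by (rule hull_mono) auto
  moreover have "cell c \<inter> cell d \<subseteq> {x. a \<bullet> x = b}"
  proof
    fix x assume x: "x \<in> cell c \<inter> cell d"
    have "b \<le> a \<bullet> x" using hull_ge[of "range (q c)" b a x] x ge unfolding cell_def by blast
    moreover have "- b \<le> - a \<bullet> v" if "v \<in> range (q d)" for v using ab(3) that by fastforce
    then have "- b \<le> (- a) \<bullet> x"
      using hull_ge[of "range (q d)" "- b" "- a" x] x unfolding cell_def by blast
    ultimately show "x \<in> {x. a \<bullet> x = b}" by simp
  qed
  ultimately show *: "cell c \<inter> cell d = convex hull (range (q c) \<inter> range (q d))"
    using C(1) by blast
  show "cell c \<inter> cell d face_of cell c" unfolding * by (rule C(2))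
qed

text \<open>
  Cells meet in faces of each other, so a vertex of one cell that lies in another cell is a
  vertex of that cell.  So the cells that have a given face are those that have its vertices.
\<close>

lemma vertex_in_cell:
  assumes "c \<in> K" "d \<in> K" "q c k \<in> cell d"
  shows "q c k \<in> range (q d)"
proof (cases "c = d")
  case False
  interpret C: cross_polytope_vertices "q c" using cross_polytope_vertices_cell assms(1) .
  let ?J = "{k. q c k \<in> range (q d)}"
  have J: "antipode_free ?J" using contact_set[OF assms(1,2) False] by metis
  have "range (q c) \<inter> range (q d) = q c ` ?J" by auto
  moreover have "q c k \<in> cell c" by (simp add: cell_def hull_inc)
  ultimately have "q c k \<in> convex hull (q c ` ?J)"
    using cell_Int(1)[OF assms(1,2) False] assms(3) by auto
  then show ?thesis using C.face_of_antipode_free(2)[OF J] by simp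
qed simp

lemma cell_subset_cell:
  assumes "c \<in> K" "d \<in> K" "cell c \<subseteq> cell d"
  shows "c = d"
proof (rule ccontr)
  assume "c \<noteq> d"
  have "q c k \<in> cell c" for k by (simp add: cell_def hull_inc)
  then have "q c k \<in> range (q d)" for k
    using vertex_in_cell[OF assms(1,2)] assms(3) by blast
  then have "antipode_free (UNIV :: ('i \<times> bool) set)"
    using contact_set[OF assms(1,2) \<open>c \<noteq> d\<close>] by (metis (no_types, lifting) Collect_cong UNIV_def)
  then show False by (auto simp: antipode_free_def)
qed

lemma polytope_cell: "polytope (cell c)"
  unfolding polytope_def cell_def by (rule exI[of _ "range (q c)"]) simp

lemma cell_in_subdivision: "c \<in> K \<Longrightarrow> cell c \<in> subdivision"
  using face_of_refl[of "cell c"] by (auto simp: subdivision_def cell_def)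

lemma polytopal_complex_subdivision: "polytopal_complex subdivision"
  unfolding polytopal_complex_def
proof (intro conjI ballI allI impI)
  have "subdivision = (\<Union>c\<in>K. {F. F face_of cell c})" by (auto simp: subdivision_def)
  then show "finite subdivision" using finite_K finite_polytope_faces[OF polytope_cell] by simp
next
  fix F assume "F \<in> subdivision" then show "polytope F"
    using face_of_polytope_polytope[OF polytope_cell] by (auto simp: subdivision_def)
next
  fix F G assume "F \<in> subdivision" "G face_of F" then show "G \<in> subdivision"
    unfolding subdivision_def using face_of_trans by blast
next
  fix F G assume "F \<in> subdivision" "G \<in> subdivision"
  then obtain c d where cd: "c \<in> K" "d \<in> K" "F face_of cell c" "G face_of cell d"
    by (auto simp: subdivision_def)
  have "cell c \<inter> cell d face_of cell c \<and> cell c \<inter> cell d face_of cell d"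
  proof (cases "c = d")
    case True then show ?thesis using face_of_refl[of "cell c"] by (auto simp: cell_def)
  next
    case False then show ?thesis using cell_Int(2) cd by (metis inf_commute)
  qed
  then show "F \<inter> G face_of F" "F \<inter> G face_of G" using face_of_Int_subface cd by blast+
qed

lemma maximal_cells_subdivision: "maximal_cells subdivision = cell ` K"
proof
  show "maximal_cells subdivision \<subseteq> cell ` K"
  proof
    fix F assume F: "F \<in> maximal_cells subdivision"
    then obtain c where c: "c \<in> K" "F face_of cell c" by (auto simp: maximal_cells_def subdivision_def)
    then have "cell c = F" using F face_of_imp_subset cell_in_subdivision
      unfolding maximal_cells_def by blast
    then show "F \<in> cell ` K" using c by blast
  qed
  show "cell ` K \<subseteq> maximal_cells subdivision"
  proof
    fix F assume "F \<in> cell ` K"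
    then obtain c where c: "c \<in> K" "F = cell c" by blast
    have "G = cell c" if G: "G \<in> subdivision" "cell c \<subseteq> G" for G
    proof -
      obtain d where d: "d \<in> K" "G face_of cell d" using G(1) by (auto simp: subdivision_def)
      then have "G \<subseteq> cell d" using face_of_imp_subset by blast
      then have "c = d" using cell_subset_cell[OF c(1) d(1)] G(2) by blast
      then show ?thesis using \<open>G \<subseteq> cell d\<close> G(2) by blast
    qed
    then show "F \<in> maximal_cells subdivision" using c cell_in_subdivision
      unfolding maximal_cells_def by blast
  qed
qed

lemma aff_dim_cell: "c \<in> K \<Longrightarrow> aff_dim (cell c) = DIM('a)"
  using cross_polytope_vertices.aff_dim_P[OF cross_polytope_vertices_cell] by (simp add: cell_def)

lemma inj_on_cell: "inj_on cell K"
  using cell_subset_cell by (auto intro: inj_onI)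

lemma num_cells_subdivision: "num_cells (DIM('a)) subdivision = card K"
proof -
  have "{C \<in> subdivision. aff_dim C = int DIM('a)} = cell ` K"
  proof (intro equalityI subsetI)
    fix F assume "F \<in> {C \<in> subdivision. aff_dim C = int DIM('a)}"
    then obtain c where c: "c \<in> K" "F face_of cell c" "aff_dim F = int DIM('a)"
      by (auto simp: subdivision_def)
    then have "F = cell c"
      using face_of_aff_dim_lt[of "cell c" F] aff_dim_cell[OF c(1)] by (auto simp: cell_def)
    then show "F \<in> cell ` K" using c by blast
  qed (auto simp: cell_in_subdivision aff_dim_cell)
  then show ?thesis unfolding num_cells_def using card_image[OF inj_on_cell] by simp
qed

text \<open>
  A facet of a cell belongs to no other cell exactly if it is one of the boundary facets.
\<close>

lemma complex_boundary_subdivision: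
  "complex_boundary subdivision = (\<lambda>J. convex hull (r ` J)) ` {J. antipode_free J}"
proof (intro equalityI subsetI)
  fix F assume "F \<in> complex_boundary subdivision"
  then obtain G where G: "G \<in> subdivision" "aff_dim G = int DIM('a) - 1" "F face_of G"
    and ex1: "\<exists>!C. C \<in> cell ` K \<and> G face_of C"
    unfolding complex_boundary_def maximal_cells_subdivision mem_Collect_eq by (elim bexE conjE)
  from G(1) obtain c where c: "c \<in> K" "G face_of cell c" by (auto simp: subdivision_def)
  interpret C: cross_polytope_vertices "q c" using cross_polytope_vertices_cell c(1) .
  obtain \<sigma> where \<sigma>: "G = convex hull (q c ` orthant \<sigma>)"
    using C.facet_face[OF c(2)[unfolded cell_def] G(2)] .
  have "\<not> (\<exists>d\<in>K. d \<noteq> c \<and> q c ` orthant \<sigma> \<subseteq> range (q d))"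
  proof
    assume "\<exists>d\<in>K. d \<noteq> c \<and> q c ` orthant \<sigma> \<subseteq> range (q d)"
    then obtain d where d: "d \<in> K" "d \<noteq> c" "q c ` orthant \<sigma> \<subseteq> range (q d)" by blast
    interpret D: cross_polytope_vertices "q d" using cross_polytope_vertices_cell d(1) .
    obtain \<tau> a b where "supports (q d) \<tau> a b" "q d ` orthant \<tau> = q c ` orthant \<sigma>"
      using shared_facet[OF c(1) d(1) d(2)[symmetric] d(3)] by metis
    then have "G face_of cell d" using D.facet_hyperplane(2) \<sigma> unfolding cell_def by metis
    then have "cell d = cell c" using ex1 c d(1) by blast
    then show False using inj_on_cell c d by (auto dest: inj_onD)
  qed
  then obtain \<rho> where \<rho>: "q c ` orthant \<sigma> = r ` orthant \<rho>" using facet_cases[OF c(1)] by blast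
  obtain W where W: "W \<subseteq> r ` orthant \<rho>" "F = convex hull W"
    using face_of_convex_hull_subset[OF finite_imp_compact[OF finite_imageI[OF finite]]
        G(3)[unfolded \<sigma> \<rho>]] .
  then obtain J where J: "J \<subseteq> orthant \<rho>" "W = r ` J" by (auto simp: subset_image_iff)
  then have "antipode_free J" using antipode_free_subset antipode_free_orthant by blast
  then show "F \<in> (\<lambda>J. convex hull (r ` J)) ` {J. antipode_free J}" using W J by blast
next
  fix F assume "F \<in> (\<lambda>J. convex hull (r ` J)) ` {J. antipode_free J}"
  then obtain J where J: "antipode_free J" "F = convex hull (r ` J)" by blast
  obtain \<rho> where \<rho>: "J \<subseteq> orthant \<rho>" using antipode_free_imp_subset_orthant[OF J(1)] .
  obtain c \<sigma> where c: "c \<in> K" "q c ` orthant \<sigma> = r ` orthant \<rho>"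
    "\<forall>d\<in>K. r ` orthant \<rho> \<subseteq> range (q d) \<longrightarrow> d = c"
    using boundary_facet[of \<rho>] by (elim bexE exE conjE)
  interpret C: cross_polytope_vertices "q c" using cross_polytope_vertices_cell c(1) .
  let ?G = "convex hull (q c ` orthant \<sigma>)"
  have G: "?G face_of cell c" "aff_dim ?G = int DIM('a) - 1"
    using C.face_of_antipode_free(1)[OF antipode_free_orthant]
      C.aff_dim_face[OF antipode_free_orthant] dim
    by (simp_all add: cell_def card_orthant)
  have uniq: "D = cell c" if D: "D \<in> cell ` K" "?G face_of D" for D
  proof -
    obtain d where d: "d \<in> K" "D = cell d" using D(1) by blast
    have "q c k \<in> range (q d)" if "k \<in> orthant \<sigma>" for k
    proof (rule vertex_in_cell[OF c(1) d(1)])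
      have "q c k \<in> ?G" using that by (simp add: hull_inc)
      then show "q c k \<in> cell d" using face_of_imp_subset[OF D(2)] d(2) by blast
    qed
    then have "r ` orthant \<rho> \<subseteq> range (q d)" unfolding c(2)[symmetric] by blast
    then have "d = c" using c(3) d(1) by blast
    then show ?thesis using d by simp
  qed
  obtain J' where J': "J' \<subseteq> orthant \<sigma>" "r ` J = q c ` J'"
    using \<rho> c(2) by (metis subset_image_iff)
  then have "antipode_free J'" using antipode_free_subset antipode_free_orthant by blast
  then have "F face_of cell c"
    using C.face_of_antipode_free(1) J(2) J'(2) by (simp add: cell_def)
  moreover have "F \<subseteq> ?G" using J(2) J' by (simp add: hull_mono image_mono)
  ultimately have "F face_of ?G" using face_of_face[OF G(1)] by blast
  then show "F \<in> complex_boundary subdivision"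
    unfolding complex_boundary_def maximal_cells_subdivision mem_Collect_eq
  proof (intro bexI[of _ ?G] conjI)
    show "\<exists>!C. C \<in> cell ` K \<and> ?G face_of C" using G(1) c(1) uniq by blast
    show "?G \<in> subdivision" using G(1) c(1) by (auto simp: subdivision_def)
  qed (rule G(2))
qed

lemma hull_boundary_subset:
  assumes J: "antipode_free J" and J': "antipode_free J'"
  shows "convex hull (r ` J) \<subseteq> convex hull (r ` J') \<longleftrightarrow> J \<subseteq> J'"
proof
  assume sub: "convex hull (r ` J) \<subseteq> convex hull (r ` J')"
  obtain \<rho> where \<rho>: "J' \<subseteq> orthant \<rho>" using antipode_free_imp_subset_orthant[OF J'] .
  obtain c \<sigma> where c: "c \<in> K" "q c ` orthant \<sigma> = r ` orthant \<rho>"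
    using boundary_facet[of \<rho>] by (elim bexE exE conjE)
  interpret C: cross_polytope_vertices "q c" using cross_polytope_vertices_cell c(1) .
  obtain L where L: "L \<subseteq> orthant \<sigma>" "r ` J' = q c ` L"
    using \<rho> c(2) by (metis subset_image_iff)
  then have af: "antipode_free L" using antipode_free_subset antipode_free_orthant by blast
  show "J \<subseteq> J'"
  proof
    fix j assume "j \<in> J"
    then have rj: "r j \<in> convex hull (q c ` L)" using sub L(2) by (auto simp: hull_inc)
    obtain \<rho>' where "antipode_free {j}" "{j} \<subseteq> orthant \<rho>'"
      using antipode_free_imp_subset_orthant[OF antipode_free_subset[OF J, of "{j}"]] \<open>j \<in> J\<close>
        antipode_free_subset[OF J, of "{j}"] by auto
    then have "r j \<in> r ` orthant \<rho>'" by blast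
    then obtain d k where d: "d \<in> K" "r j = q d k" using boundary_facet[of \<rho>'] by (metis imageE)
    have "convex hull (q c ` L) \<subseteq> cell c" unfolding cell_def by (rule hull_mono) auto
    then have "r j \<in> range (q c)" using vertex_in_cell[OF d(1) c(1), of k] rj d(2) by auto
    then obtain l where l: "r j = q c l" by blast
    then have "l \<in> L" using C.face_of_antipode_free(2)[OF af] rj by simp
    then have "r j \<in> r ` J'" using l L(2) by auto
    then show "j \<in> J'" using inj_r by (auto dest: injD)
  qed
qed (simp add: hull_mono image_mono)

text \<open>
  Where the other facet inequalities are strict, a cell agrees locally with the halfspace of the
  remaining facet; any supporting plane of this facet may be used for it.
\<close>

lemma cell_near_facet:
  assumes c: "c \<in> K" and sup: "\<And>\<tau>. supports (q c) \<tau> (a \<tau>) (b \<tau>)" "supports (q c) \<sigma> n m"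
    and y: "\<And>\<tau>. \<tau> \<noteq> \<sigma> \<Longrightarrow> b \<tau> < a \<tau> \<bullet> y"
  shows "\<forall>\<^sub>F z in nhds y. m \<le> n \<bullet> z \<longrightarrow> z \<in> cell c"
proof -
  interpret C: cross_polytope_vertices "q c" using cross_polytope_vertices_cell c .
  let ?a = "a(\<sigma> := n)" and ?b = "b(\<sigma> := m)"
  have "\<forall>\<^sub>F z in nhds y. \<forall>\<tau>\<in>- {\<sigma>}. b \<tau> < a \<tau> \<bullet> z"
  proof (rule eventually_ball_finite[OF finite], intro ballI)
    fix \<tau> assume "\<tau> \<in> - {\<sigma>}"
    then show "\<forall>\<^sub>F z in nhds y. b \<tau> < a \<tau> \<bullet> z"
      using y by (intro order_tendstoD(1)[where y = "a \<tau> \<bullet> y"] tendsto_intros filterlim_ident) auto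
  qed
  then show ?thesis
  proof eventually_elim
    case (elim z)
    have "supports (q c) \<tau> (?a \<tau>) (?b \<tau>)" for \<tau> using sup by simp
    from C.halfspace_representation[OF this, of z] show ?case
      using elim unfolding cell_def by (auto simp: less_imp_le)
  qed
qed

text \<open>
  If the union of the cells misses \<open>x\<close>, it misses a neighbourhood of \<open>x\<close>.  A generic segment from
  inside a cell to a point of this neighbourhood meets no intersection of two facet planes
  of the same cell.  Its last point in the union of the cells would lie inside a cell or
  inside a facet; in the latter case the facet is shared, because the segment
  stays inside \<open>S\<close>, and the two cells together contain a neighbourhood of the point.
\<close>

lemma interior_S_covered:
  assumes x: "x \<in> interior S"
  shows "x \<in> (\<Union>c\<in>K. cell c)"
proof (rule ccontr)
  let ?U = "\<Union>c\<in>K. cell c"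
  assume "x \<notin> ?U"
  have closed_U: "closed ?U"
    using finite_K polytope_cell polytope_imp_closed by (intro closed_UN) auto
  have "open (interior S \<inter> - ?U)" using closed_U by (intro open_Int open_interior open_Compl)
  then obtain V where V: "V = interior S \<inter> - ?U" "open V" "x \<in> V" using x \<open>x \<notin> ?U\<close> by blast
  have "\<forall>c\<in>K. \<forall>\<sigma>. \<exists>a b. supports (q c) \<sigma> a b"
    using cross_polytope_vertices_cell cross_polytope_vertices.facet by blast
  then obtain A B where sup: "\<And>c \<sigma>. c \<in> K \<Longrightarrow> supports (q c) \<sigma> (A c \<sigma>) (B c \<sigma>)" by metis
  define L where "L c \<sigma> z = A c \<sigma> \<bullet> z - B c \<sigma>" for c \<sigma> z
  have A0: "A c \<sigma> \<noteq> 0" if "c \<in> K" for c \<sigma>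
    using sup[OF that, of \<sigma>] unfolding supports_def by auto
  obtain c0 where c0: "c0 \<in> K" using K_nonempty by blast
  have cell_S: "cell c \<subseteq> S" if "c \<in> K" for c
    unfolding cell_def using cell_subset[OF that] convex_S by (simp add: subset_hull)

  \<comment> \<open>The starting point avoids all facet planes, so that the condition on the end point below
  excludes only a null set.\<close>
  obtain p where p: "p \<in> interior (cell c0)" "\<And>c \<sigma>. c \<in> K \<Longrightarrow> L c \<sigma> p \<noteq> 0"
  proof -
    let ?N = "\<Union>c\<in>K. \<Union>\<sigma>. {z. A c \<sigma> \<bullet> z = B c \<sigma>}"
    have "negligible ?N"
      by (rule negligible_UN[OF finite_K], rule negligible_UN[OF finite], rule negligible_hyperplane)
         (simp add: A0)
    moreover have "\<not> negligible (interior (cell c0))"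
      using cross_polytope_vertices.interior_P[OF cross_polytope_vertices_cell[OF c0]]
      by (intro open_not_negligible) (auto simp: cell_def)
    ultimately have "\<not> interior (cell c0) \<subseteq> ?N" using negligible_subset by blast
    then obtain p where "p \<in> interior (cell c0)" "p \<notin> ?N" by blast
    then show thesis by (intro that[of p]) (auto simp: L_def)
  qed

  \<comment> \<open>If \<open>L c \<sigma>\<close> and \<open>L c \<tau>\<close> vanish at a common point of the segment from \<open>p\<close> to \<open>x'\<close>, then their
  values at \<open>p\<close> and at \<open>x'\<close> are proportional.\<close>
  obtain x' where x': "x' \<in> V"
    "\<And>c \<sigma> \<tau>. c \<in> K \<Longrightarrow> \<sigma> \<noteq> \<tau> \<Longrightarrow> L c \<sigma> p * L c \<tau> x' \<noteq> L c \<tau> p * L c \<sigma> x'"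
  proof -
    let ?H = "\<lambda>c \<sigma> \<tau>. {z. L c \<sigma> p * L c \<tau> z = L c \<tau> p * L c \<sigma> z}"
    let ?N = "\<Union>c\<in>K. \<Union>\<sigma>. \<Union>\<tau>\<in>- {\<sigma>}. ?H c \<sigma> \<tau>"
    have "negligible (?H c \<sigma> \<tau>)" if c: "c \<in> K" and ne: "\<sigma> \<noteq> \<tau>" for c \<sigma> \<tau>
    proof -
      let ?n = "L c \<sigma> p *\<^sub>R A c \<tau> - L c \<tau> p *\<^sub>R A c \<sigma>"
      let ?m = "L c \<sigma> p * B c \<tau> - L c \<tau> p * B c \<sigma>"
      have H: "?H c \<sigma> \<tau> = {z. ?n \<bullet> z = ?m}"
        by (auto simp: L_def algebra_simps)
      obtain i where "\<tau> i = (\<not> \<sigma> i)" using ne by fastforce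
      then have "L c \<sigma> (q c (i, \<sigma> i)) = 0" "L c \<tau> (q c (i, \<sigma> i)) > 0"
        using sup[OF c, of \<sigma>] sup[OF c, of \<tau>] unfolding supports_def L_def by (auto dest: spec[of _ i])
      then have "q c (i, \<sigma> i) \<notin> ?H c \<sigma> \<tau>" using p(2)[OF c] by auto
      then have "?n \<noteq> 0 \<or> ?m \<noteq> 0" unfolding H by auto
      then show ?thesis unfolding H by (rule negligible_hyperplane)
    qed
    then have "negligible ?N"
      by (intro negligible_UN[OF finite_K] negligible_UN[OF finite]) auto
    moreover have "\<not> negligible V" using V by (intro open_not_negligible) auto
    ultimately have "\<not> V \<subseteq> ?N" using negligible_subset by blast
    then obtain z where "z \<in> V" "z \<notin> ?N" by blast
    then show thesis by (intro that[of z]) auto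
  qed

  have "p \<in> ?U" using p(1) c0 interior_subset by blast
  then have "closed_segment p x' \<inter> ?U \<noteq> {}" "closed_segment p x' - ?U \<noteq> {}"
    using x'(1) V(1) by auto
  then have "closed_segment p x' \<inter> frontier ?U \<noteq> {}"
    by (intro connected_Int_frontier connected_segment)
  then obtain y where y: "y \<in> closed_segment p x'" "y \<in> frontier ?U" by blast
  have "p \<in> interior S" using p(1) interior_mono[OF cell_S[OF c0]] by blast
  then have yS: "y \<in> interior S"
    using y(1) x'(1) V(1) convex_interior[OF convex_S] by (meson IntD1 closed_segment_subset subsetD)
  obtain c where c: "c \<in> K" "y \<in> cell c"
    using y(2) frontier_subset_closed[OF closed_U] by blast
  obtain t where t: "0 \<le> t" "t \<le> 1" "y = (1 - t) *\<^sub>R p + t *\<^sub>R x'"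
    using y(1) unfolding closed_segment_def by blast
  have Ly: "L d \<sigma> y = (1 - t) * L d \<sigma> p + t * L d \<sigma> x'" for d \<sigma>
    unfolding t(3) L_def by (simp add: algebra_simps)
  have generic: "L d \<tau> y \<noteq> 0" if d: "d \<in> K" and "\<tau> \<noteq> \<sigma>" "L d \<sigma> y = 0" for d \<sigma> \<tau>
  proof
    assume "L d \<tau> y = 0"
    then have "t * (L d \<sigma> p * L d \<tau> x' - L d \<tau> p * L d \<sigma> x') = 0"
      using that(3) unfolding Ly by algebra
    then have "t = 0" using x'(2)[OF d, of \<sigma> \<tau>] that(2) by auto
    then show False using that(3) p(2)[OF d] Ly by auto
  qed
  have pos: "B d \<tau> < A d \<tau> \<bullet> y" if "d \<in> K" "y \<in> cell d" "L d \<tau> y \<noteq> 0" for d \<tau>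
    using cross_polytope_vertices.facet_hyperplane(3)[OF cross_polytope_vertices_cell[OF that(1)]
        sup[OF that(1), of \<tau>], of y] that(2,3)
    unfolding cell_def L_def by simp
  have "\<forall>\<^sub>F z in nhds y. z \<in> ?U"
  proof (cases "\<exists>\<sigma>. L c \<sigma> y = 0")
    case False
    let ?\<sigma> = "\<lambda>_. True"
    have "\<forall>\<^sub>F z in nhds y. B c ?\<sigma> < A c ?\<sigma> \<bullet> z"
      using pos[OF c] False by (intro order_tendstoD(1)[where y = "A c ?\<sigma> \<bullet> y"] tendsto_intros filterlim_ident) auto
    moreover have "\<forall>\<^sub>F z in nhds y. B c ?\<sigma> \<le> A c ?\<sigma> \<bullet> z \<longrightarrow> z \<in> cell c"
      using pos[OF c] False c(1) sup by (intro cell_near_facet[where a = "A c" and b = "B c"]) auto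
    ultimately show ?thesis by eventually_elim (use c(1) in auto)
  next
    case True
    then obtain \<sigma> where \<sigma>: "L c \<sigma> y = 0" by blast
    interpret C: cross_polytope_vertices "q c" using cross_polytope_vertices_cell c(1) .
    have yT: "y \<in> convex hull (q c ` orthant \<sigma>)"
      using C.facet_hyperplane(1)[OF sup[OF c(1)], of \<sigma>] \<sigma> c(2) unfolding cell_def L_def by auto
    from facet_cases[OF c(1), of \<sigma>] show ?thesis
    proof (elim disjE bexE exE conjE)
      fix d assume d: "d \<in> K" "d \<noteq> c" "q c ` orthant \<sigma> \<subseteq> range (q d)"
      interpret D: cross_polytope_vertices "q d" using cross_polytope_vertices_cell d(1) .
      obtain a b \<tau> where ab: "supports (q c) \<sigma> a b" "supports (q d) \<tau> (- a) (- b)"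
        "q d ` orthant \<tau> = q c ` orthant \<sigma>"
        using shared_facet[OF c(1) d(1) d(2)[symmetric] d(3)] .
      have yd: "y \<in> cell d" "L d \<tau> y = 0"
        using yT ab(3) D.facet_hyperplane(1)[OF sup[OF d(1)], of \<tau>] unfolding cell_def L_def by auto
      have "\<forall>\<^sub>F z in nhds y. b \<le> a \<bullet> z \<longrightarrow> z \<in> cell c"
        using pos[OF c] generic[OF c(1) _ \<sigma>] c(1) sup ab(1)
        by (intro cell_near_facet[where a = "A c" and b = "B c"]) auto
      moreover have "\<forall>\<^sub>F z in nhds y. - b \<le> - a \<bullet> z \<longrightarrow> z \<in> cell d"
        using pos[OF d(1) yd(1)] generic[OF d(1) _ yd(2)] d(1) sup ab(2)
        by (intro cell_near_facet[where a = "A d" and b = "B d"]) auto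
      ultimately show ?thesis by eventually_elim (use c(1) d(1) in auto)
    next
      fix \<rho> a b
      assume ab: "supports (q c) \<sigma> a b" "\<forall>x\<in>S. b \<le> a \<bullet> x"
      have "a \<noteq> 0" using ab(1) unfolding supports_def by auto
      then have "interior S \<subseteq> {x. b < a \<bullet> x}"
        using interior_mono[of S "{x. b \<le> a \<bullet> x}"] ab(2) by auto
      moreover have "a \<bullet> y = b" using C.facet_hyperplane(1)[OF ab(1)] yT by blast
      ultimately show ?thesis using yS by auto
    qed
  qed
  then have "y \<in> interior ?U" unfolding eventually_nhds by (auto intro: interiorI)
  then show False using y(2) by (simp add: frontier_def)
qed

lemma Union_subdivision: "\<Union>subdivision = S"
proof
  have cell_S: "cell c \<subseteq> S" if "c \<in> K" for c
    unfolding cell_def using cell_subset[OF that] convex_S by (simp add: subset_hull)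
  show "\<Union>subdivision \<subseteq> S" using cell_S face_of_imp_subset by (fastforce simp: subdivision_def)
  obtain c where c: "c \<in> K" using K_nonempty by blast
  have "interior S \<noteq> {}"
    using cross_polytope_vertices.interior_P[OF cross_polytope_vertices_cell[OF c]]
      interior_mono[OF cell_S[OF c]] unfolding cell_def by blast
  then have "closure (interior S) = S"
    using convex_closure_interior[OF convex_S] closed_S by simp
  moreover have "closed (\<Union>c\<in>K. cell c)"
    using finite_K polytope_cell polytope_imp_closed by (intro closed_UN) auto
  ultimately have "S \<subseteq> (\<Union>c\<in>K. cell c)"
    using interior_S_covered closure_minimal[of "interior S" "\<Union>c\<in>K. cell c"] by blast
  then show "S \<subseteq> \<Union>subdivision" using cell_in_subdivision by blast
qed

lemma is_cross_polytopal_subdivision: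
  assumes regular: "face_lattice (regular_cross_polytope :: 'a set) \<simeq>\<^sub>c
    insert UNIV {J :: ('i \<times> bool) set. antipode_free J}"
  shows "cross_polytopal_subdivision subdivision S"
proof -
  have "cross_polytope (cell c)" if "c \<in> K" for c
    unfolding cross_polytope_def
  proof
    show "face_lattice (cell c) \<simeq>\<^sub>c face_lattice (regular_cross_polytope :: 'a set)"
      using comb_equiv_sym[OF comb_equiv_trans[OF regular
        cross_polytope_vertices.face_lattice_equiv[OF cross_polytope_vertices_cell[OF that]]]]
      by (simp add: cell_def)
  qed (rule polytope_cell)
  then show ?thesis
    unfolding cross_polytopal_subdivision_def cross_polytopal_complex_def pure_complex_def
      maximal_cells_subdivision
    using polytopal_complex_subdivision Union_subdivision aff_dim_cell by auto
qed

lemma complex_boundary_equiv: "{J :: ('i \<times> bool) set. antipode_free J} \<simeq>\<^sub>c complex_boundary subdivision"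
  unfolding complex_boundary_subdivision using hull_boundary_subset by (intro comb_equiv_image) blast

end

section \<open>Octahedra with labelled vertices\<close>

type_synonym point = "int \<times> int \<times> int"
text \<open>
  Six items attached to the vertices of an octahedron, grouped by its three diagonals: the
  vertices themselves, or weights at the vertices.
\<close>

type_synonym 'b hexad = "('b \<times> 'b) \<times> ('b \<times> 'b) \<times> ('b \<times> 'b)"

fun corner :: "'b hexad \<Rightarrow> 3 \<times> bool \<Rightarrow> 'b" where
  "corner (d1, d2, d3) (i, s) =
     (if s then fst else snd) (if i = 1 then d1 else if i = 2 then d2 else d3)"

fun vertices :: "'b hexad \<Rightarrow> 'b list" where
  "vertices ((a, a'), (b, b'), (c, c')) = [a, a', b, b', c, c']"

fun facets :: "'b hexad \<Rightarrow> 'b list list" where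
  "facets ((a, a'), (b, b'), (c, c')) =
     [[a, b, c], [a, b, c'], [a, b', c], [a, b', c'], [a', b, c], [a', b, c'], [a', b', c], [a', b', c']]"

lemma range_corner: "range (corner c) = set (vertices c)"
proof -
  obtain a a' b b' d d' where c: "c = ((a, a'), (b, b'), (d, d'))" by (metis surj_pair)
  have "range (corner c) = (\<Union>i. {corner c (i, True), corner c (i, False)})"
    by (auto simp: image_iff) (metis (full_types))+
  then show ?thesis unfolding UNIV_3 unfolding c by simp auto
qed

lemma corner_orthant: "corner c ` orthant \<sigma> = {corner c (1, \<sigma> 1), corner c (2, \<sigma> 2), corner c (3, \<sigma> 3)}"
  by (simp add: orthant_def UNIV_3 image_image)

lemma orthant_in_facets: "\<exists>T\<in>set (facets c). corner c ` orthant \<sigma> = set T"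
proof -
  obtain a a' b b' d d' where c: "c = ((a, a'), (b, b'), (d, d'))" by (metis surj_pair)
  show ?thesis unfolding corner_orthant unfolding c
    by (cases "\<sigma> 1"; cases "\<sigma> 2"; cases "\<sigma> 3") simp_all
qed

lemma facets_orthant:
  assumes "T \<in> set (facets c)"
  shows "\<exists>\<sigma>. corner c ` orthant \<sigma> = set T"
proof -
  obtain a a' b b' d d' where c: "c = ((a, a'), (b, b'), (d, d'))" by (metis surj_pair)
  let ?T = "\<lambda>s1 s2 s3. [corner c (1, s1), corner c (2, s2), corner c (3, s3)]"
  have "T = ?T True True True \<or> T = ?T True True False \<or> T = ?T True False True \<or>
    T = ?T True False False \<or> T = ?T False True True \<or> T = ?T False True False \<or>
    T = ?T False False True \<or> T = ?T False False False"
    using assms unfolding c by simp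
  then obtain s1 s2 s3 where "T = ?T s1 s2 s3" by blast
  then have "corner c ` orthant (\<lambda>i. if i = 1 then s1 else if i = 2 then s2 else s3) = set T"
    unfolding corner_orthant by simp
  then show ?thesis by blast
qed

section \<open>The twenty-three octahedra\<close>

text \<open>
  The symmetries of the tetrahedron \<open>(\<plusminus>5,0,5), (0,\<plusminus>5,-5)\<close> that preserve the pair of opposite edges
  bisected by \<open>(0,0,\<plusminus>5)\<close>.  They are generated by two reflections and a map that exchanges these
  two edges.
\<close>

fun symmetry :: "bool \<times> int \<times> int \<Rightarrow> point \<Rightarrow> point" where
  "symmetry (swap, s, t) (x, y, z) = (if swap then (s * y, t * x, - z) else (s * x, t * y, z))"

definition symmetries :: "(bool \<times> int \<times> int) list" where
  "symmetries = [(False, 1, 1), (False, 1, -1), (False, -1, 1), (False, -1, -1),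
                 (True, 1, 1), (True, 1, -1), (True, -1, 1), (True, -1, -1)]"

fun map_hexad :: "('b \<Rightarrow> 'c) \<Rightarrow> 'b hexad \<Rightarrow> 'c hexad" where
  "map_hexad f ((a, a'), (b, b'), (c, c')) = ((f a, f a'), (f b, f b'), (f c, f c'))"

text \<open>
  One octahedron from each of the five orbits under the symmetries, preceded by
  representatives of the cosets of its stabiliser, and followed by an affine dependence of its
  vertices for every diagonal.  In the 24-cell with vertices \<open>\<plusminus>e\<^sub>i \<plusminus> e\<^sub>j\<close>, looked at through the
  facet in direction \<open>e\<^sub>4\<close>, the orbits belong to the facets in the directions \<open>-e\<^sub>4\<close>, \<open>\<plusminus>e\<^sub>3\<close>, \<open>\<plusminus>e\<^sub>1\<close> and \<open>\<plusminus>e\<^sub>2\<close>, \<open>(\<plusminus>1, \<plusminus>1, \<plusminus>1, 1)\<close>, and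
  \<open>(\<plusminus>1, \<plusminus>1, \<plusminus>1, -1)\<close>.  The vertex coordinates were found by a numerical search.
\<close>

definition orbits :: "((bool \<times> int \<times> int) list \<times> point hexad \<times> int hexad \<times> int hexad \<times> int hexad) list"
  where "orbits =
  [([(False, 1, 1)],
    (((1,0,0), (-1,0,0)), ((0,1,0), (0,-1,0)), ((0,0,1), (0,0,-1))),
    ((-2,-2), (1,1), (1,1)), ((1,1), (-2,-2), (1,1)), ((1,1), (1,1), (-2,-2))),
   ([(False, 1, 1), (True, 1, 1)],
    (((3,0,4), (-3,0,4)), ((0,1,2), (0,-1,2)), ((0,0,5), (0,0,1))),
    ((-5,-5), (1,1), (7,1)), ((1,1), (-5,-5), (1,7)), ((1,1), (1,1), (-2,-2))),
   ([(False, 1, 1), (False, -1, 1), (True, 1, 1), (True, 1, -1)],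
    (((5,0,5), (1,0,0)), ((3,0,4), (1,0,-2)), ((2,2,0), (2,-2,0))),
    ((-2,-4), (3,1), (1,1)), ((2,6), (-5,-5), (1,1)), ((4,1), (1,12), (-9,-9))),
   (symmetries,
    (((5,0,5), (0,1,2)), ((3,0,4), (0,5,-5)), ((2,2,0), (0,0,5))),
    ((-4,-7), (6,1), (1,3)), ((2,1), (-8,-3), (7,1)), ((1,3), (1,1), (-4,-2))),
   (symmetries,
    (((3,0,4), (0,1,0)), ((2,2,0), (0,0,1)), ((1,0,0), (0,1,2))),
    ((-2,-7), (2,2), (2,3)), ((1,5), (-4,-10), (5,3)), ((1,2), (2,8), (-7,-6)))]"

definition octahedra :: "(point hexad \<times> int hexad \<times> int hexad \<times> int hexad) list" where
  "octahedra = concat (map (\<lambda>(gs, c, w). map (\<lambda>g. (map_hexad (symmetry g) c, w)) gs) orbits)"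

text \<open>
  The vertices of the tetrahedron together with the midpoints of two opposite edges: the outer
  octahedron of the Schlegel diagram.
\<close>

definition outer :: "point hexad" where
  "outer = (((5,0,5), (-5,0,5)), ((0,5,-5), (0,-5,-5)), ((0,0,5), (0,0,-5)))"

fun height :: "point \<times> int \<Rightarrow> point \<Rightarrow> int" where
  "height ((a, b, c), d) (x, y, z) = a * x + b * y + c * z + d"

definition walls :: "(point \<times> int) list" where
  "walls = [((2,0,1),5), ((-2,0,1),5), ((0,2,-1),5), ((0,-2,-1),5)]"

text \<open>
  The quantifiers over lists, and the tests built on them, use conditionals so that evaluation
  by rewriting stops as soon as the result is known.
\<close>

fun any :: "('b \<Rightarrow> bool) \<Rightarrow> 'b list \<Rightarrow> bool" where
  "any P [] = False"
| "any P (x # xs) = (if P x then True else any P xs)"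

fun every :: "('b \<Rightarrow> bool) \<Rightarrow> 'b list \<Rightarrow> bool" where
  "every P [] = True"
| "every P (x # xs) = (if P x then every P xs else False)"

lemma any_iff: "any P xs \<longleftrightarrow> (\<exists>x\<in>set xs. P x)" by (induction xs) auto
lemma every_iff: "every P xs \<longleftrightarrow> (\<forall>x\<in>set xs. P x)" by (induction xs) auto

definition subset_list :: "'b list \<Rightarrow> 'b list \<Rightarrow> bool" where
  "subset_list T c \<longleftrightarrow> every (\<lambda>p. any ((=) p) c) T"

lemma subset_list_iff: "subset_list T c \<longleftrightarrow> set T \<subseteq> set c"
  by (auto simp: subset_list_def every_iff any_iff)

definition admissible :: "'b list \<Rightarrow> 'b \<Rightarrow> int \<Rightarrow> bool" where
  "admissible T p v \<longleftrightarrow> (if 0 < v then True else if v = 0 then any ((=) p) T else False)"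

lemma admissible_iff: "admissible T p v \<longleftrightarrow> 0 < v \<or> v = 0 \<and> p \<in> set T"
  by (auto simp: admissible_def any_iff)

definition separates :: "point \<times> int \<Rightarrow> point hexad \<Rightarrow> point hexad \<Rightarrow> bool" where
  "separates h c d \<longleftrightarrow>
     every (\<lambda>p. admissible (vertices d) p (height h p)) (vertices c) \<and>
     every (\<lambda>p. admissible (vertices c) p (- height h p)) (vertices d) \<and>
     any (\<lambda>p. 0 < height h p) (vertices c) \<and> any (\<lambda>p. height h p < 0) (vertices d)"

text \<open>
  The first list of planes refers to the first octahedron, with one plane for each later one.
\<close>

fun apart :: "point hexad list \<Rightarrow> (point \<times> int) list list \<Rightarrow> bool" where
  "apart (c # cs) (hs # hss) \<longleftrightarrow> list_all2 (\<lambda>d h. separates h c d) cs hs \<and> apart cs hss"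
| "apart cs hss \<longleftrightarrow> cs = [] \<and> hss = []"

text \<open>
  Common vertices of two cells contain no pair of antipodes, so a second cell that contains the
  three vertices of a triangle shares exactly this triangle.  A triangle without a second cell has
  to be one of the outer octahedron and to lie in a face of the tetrahedron; the plane of this
  face then serves as its supporting plane.
\<close>

definition facet_ok :: "point hexad \<Rightarrow> point list \<Rightarrow> bool" where
  "facet_ok c T \<longleftrightarrow>
     (if any (\<lambda>(d, _). if subset_list T (vertices d) then d \<noteq> c else False) octahedra then True
      else any (\<lambda>B. if subset_list T B then subset_list B T else False) (facets outer) \<and>
           any (\<lambda>h. every (\<lambda>p. admissible T p (height h p)) (vertices c) \<and>
                    every (\<lambda>p. height h p = 0) T) walls)"

definition outer_facet_ok :: "point list \<Rightarrow> bool" where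
  "outer_facet_ok B \<longleftrightarrow>
     (case filter (\<lambda>(c, _). subset_list B (vertices c)) octahedra of
        [(c, _)] \<Rightarrow> any (\<lambda>T. if subset_list T B then subset_list B T else False) (facets c)
      | _ \<Rightarrow> False)"

fun dependence :: "int hexad \<Rightarrow> point hexad \<Rightarrow> bool" where
  "dependence w c \<longleftrightarrow>
     sum_list (vertices w) = 0 \<and>
     sum_list (map2 (\<lambda>a (x, y, z). a * x) (vertices w) (vertices c)) = 0 \<and>
     sum_list (map2 (\<lambda>a (x, y, z). a * y) (vertices w) (vertices c)) = 0 \<and>
     sum_list (map2 (\<lambda>a (x, y, z). a * z) (vertices w) (vertices c)) = 0"

fun balanced :: "point hexad \<times> int hexad \<times> int hexad \<times> int hexad \<Rightarrow> bool" where
  "balanced (c, (u1, u2, u3), (v1, v2, v3), (w1, w2, w3)) \<longleftrightarrow>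
     dependence (u1, u2, u3) c \<and> dependence (v1, v2, v3) c \<and> dependence (w1, w2, w3) c \<and>
     list_all (\<lambda>(a, a'). 0 < a \<and> 0 < a') [u2, u3, v1, v3, w1, w2]"

text \<open>
  The \<open>i\<close>-th row contains, for every later octahedron, an affine function that is nonnegative on
  the \<open>i\<close>-th octahedron, nonpositive on the later one, and zero at no other vertices of the two than
  the common ones.  Such a function always exists for two polytopes that meet in a common face: the origin lies in the
  relative interior of a face of their Minkowski difference, and a hyperplane that exposes
  this face will do.
\<close>

definition planes :: "(point \<times> int) list list" where
  "planes =
    [
     [((0,0,-1),1), ((0,0,1),1), ((-3,0,1),3), ((3,0,1),3), ((0,-3,-1),3), ((0,3,-1),3),
      ((-1,-3,-1),4), ((-1,3,-1),4), ((1,-3,-1),4), ((1,3,-1),4), ((-3,-1,1),4), ((-3,1,1),4),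
      ((3,-1,1),4), ((3,1,1),4), ((-1,-1,-1),1), ((-1,1,-1),1), ((1,-1,-1),1), ((1,1,-1),1),
      ((-1,-1,1),1), ((-1,1,1),1), ((1,-1,1),1), ((1,1,1),1)],
     [((0,0,1),0), ((-3,0,2),1), ((3,0,2),1), ((0,-2,1),0), ((0,2,1),0), ((-1,-9,-3),15),
      ((-1,9,-3),15), ((1,-9,-3),15), ((1,9,-3),15), ((-2,0,2),-1), ((-2,0,2),-1), ((2,0,2),-1),
      ((2,0,2),-1), ((-1,-1,1),-1), ((-1,1,1),-1), ((1,-1,1),-1), ((1,1,1),-1), ((-1,-1,1),0),
      ((-1,1,1),0), ((1,-1,1),0), ((1,1,1),0)],
     [((-2,0,-1),0), ((2,0,-1),0), ((0,-3,-2),1), ((0,3,-2),1), ((0,-2,-2),-1), ((0,2,-2),-1),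
      ((0,-2,-2),-1), ((0,2,-2),-1), ((-9,-1,3),15), ((-9,1,3),15), ((9,-1,3),15), ((9,1,3),15),
      ((-1,-1,-1),0), ((-1,1,-1),0), ((1,-1,-1),0), ((1,1,-1),0), ((-1,-1,-1),-1),
      ((-1,1,-1),-1), ((1,-1,-1),-1), ((1,1,-1),-1)],
     [((1,0,0),0), ((1,-1,0),0), ((1,1,0),0), ((2,-7,-4),10), ((2,7,-4),10), ((2,0,0),-1),
      ((2,0,0),-1), ((-14,-1,8),30), ((-14,1,8),30), ((2,0,0),-1), ((2,0,0),-1), ((2,-1,-1),-2),
      ((2,1,-1),-2), ((2,0,0),-1), ((2,0,0),-1), ((2,-1,0),-2), ((2,1,0),-2), ((2,0,0),-1),
      ((2,0,0),-1)],
     [((-1,-1,0),0), ((-1,1,0),0), ((-2,0,0),-1), ((-2,0,0),-1), ((-2,-7,-4),10),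
      ((-2,7,-4),10), ((-2,0,0),-1), ((-2,0,0),-1), ((14,-1,8),30), ((14,1,8),30),
      ((-2,0,0),-1), ((-2,0,0),-1), ((-2,-1,-1),-2), ((-2,1,-1),-2), ((-2,0,0),-1),
      ((-2,0,0),-1), ((-2,-1,0),-2), ((-2,1,0),-2)],
     [((0,1,0),0), ((-1,-14,-8),30), ((0,2,0),-1), ((1,-14,-8),30), ((0,2,0),-1), ((-7,2,4),10),
      ((0,2,0),-1), ((7,2,4),10), ((0,2,0),-1), ((-1,2,0),-2), ((0,2,0),-1), ((1,2,0),-2),
      ((0,2,0),-1), ((-1,2,1),-2), ((0,2,0),-1), ((1,2,1),-2), ((0,2,0),-1)],
     [((0,-2,0),-1), ((-1,14,-8),30), ((0,-2,0),-1), ((1,14,-8),30), ((0,-2,0),-1),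
      ((-7,-2,4),10), ((0,-2,0),-1), ((7,-2,4),10), ((0,-2,0),-1), ((-1,-2,0),-2),
      ((0,-2,0),-1), ((1,-2,0),-2), ((0,-2,0),-1), ((-1,-2,1),-2), ((0,-2,0),-1), ((1,-2,1),-2)],
     [((0,1,0),0), ((1,0,0),0), ((1,1,0),0), ((-1,1,1),0), ((-1,2,1),0), ((2,1,1),0),
      ((1,2,1),-1), ((0,2,1),-4), ((0,3,1),-4), ((1,2,1),-4), ((1,2,1),-2), ((-1,3,2),-4),
      ((0,2,1),-1), ((3,2,1),-3), ((0,2,1),-1)],
     [((1,-1,0),0), ((1,0,0),0), ((-1,-2,1),0), ((-1,-1,1),0), ((1,-2,1),-1), ((2,-1,1),0),
      ((0,-3,1),-4), ((0,-2,1),-4), ((1,-2,1),-2), ((1,-2,1),-4), ((0,-2,1),-1), ((-1,-3,2),-4),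
      ((0,-2,1),-1), ((3,-2,1),-3)],
     [((0,1,0),0), ((-2,1,1),0), ((-2,1,1),1), ((1,1,1),0), ((1,2,1),0), ((-1,2,1),-4),
      ((-1,2,1),-2), ((0,2,1),-4), ((0,3,1),-4), ((-3,2,1),-3), ((-1,2,1),0), ((1,3,2),-4),
      ((0,2,1),-1)],
     [((-2,-2,1),0), ((-2,-1,1),0), ((1,-2,1),0), ((1,-1,1),0), ((-1,-2,1),-2), ((-1,-2,1),-4),
      ((0,-3,1),-4), ((0,-2,1),-4), ((-1,-2,1),0), ((-3,-2,1),-3), ((0,-2,1),-1), ((1,-3,2),-4)],
     [((0,1,0),0), ((1,0,0),0), ((1,1,0),0), ((3,-1,-2),-4), ((2,3,-1),-3), ((2,0,-1),-1),
      ((2,0,-1),-1), ((2,0,-1),-4), ((2,1,-1),-4), ((3,0,-1),-4), ((2,1,-1),-2)],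
     [((1,-1,0),0), ((1,0,0),0), ((2,-3,-1),-3), ((3,1,-2),-4), ((2,-1,-1),0), ((2,0,-1),-1),
      ((2,-1,-1),-4), ((2,0,-1),-4), ((2,-1,-1),-2), ((3,0,-1),-4)],
     [((0,1,0),0), ((-2,0,-1),-1), ((-2,0,-1),-1), ((-3,-1,-2),-4), ((-2,3,-1),-3),
      ((-3,0,-1),-4), ((-2,1,-1),-2), ((-2,0,-1),-4), ((-2,1,-1),-4)],
     [((-2,-1,-1),0), ((-2,0,-1),-1), ((-2,-3,-1),-3), ((-3,1,-2),-4), ((-2,-1,-1),-2),
      ((-3,0,-1),-4), ((-2,-1,-1),-4), ((-2,0,-1),-4)],
     [((0,1,0),0), ((1,0,0),0), ((1,1,0),0), ((0,0,1),0), ((0,1,1),0), ((1,0,1),0), ((1,1,1),0)],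
     [((1,-1,0),0), ((1,0,0),0), ((0,-1,1),0), ((0,0,1),0), ((1,-1,1),0), ((1,0,1),0)],
     [((0,1,0),0), ((-1,0,1),0), ((-1,1,1),0), ((0,0,1),0), ((0,1,1),0)],
     [((-1,-1,1),0), ((-1,0,1),0), ((0,-1,1),0), ((0,0,1),0)],
     [((0,1,0),0), ((1,0,0),0), ((1,1,0),0)],
     [((1,-1,0),0), ((1,0,0),0)],
     [((0,1,0),0)],
     []]"

lemma octahedra_apart: "apart (map fst octahedra) planes"
  by code_simp

lemma octahedra_facets: "every (\<lambda>(c, _). every (facet_ok c) (facets c)) octahedra"
  by code_simp

lemma outer_facets: "every outer_facet_ok (facets outer)"
  by code_simp

lemma octahedra_balanced: "every balanced octahedra"
  by code_simp

lemma octahedra_inside: "every (\<lambda>(c, _). every (\<lambda>p. every (\<lambda>h. 0 \<le> height h p) walls) (vertices c)) octahedra"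
  by code_simp

lemma length_octahedra: "length octahedra = 23"
  by code_simp

lemma inj_corner:
  assumes "distinct (vertices c)"
  shows "inj (corner c)"
proof (rule eq_card_imp_inj_on)
  obtain a a' b b' d d' where "c = ((a, a'), (b, b'), (d, d'))" by (metis surj_pair)
  then have "length (vertices c) = 6" by simp
  then show "card (range (corner c)) = card (UNIV :: (3 \<times> bool) set)"
    using distinct_card[OF assms] by (simp add: range_corner)
qed simp

text \<open>
  These are the four coordinates of the dependence of the points \<open>(1, x, y, z)\<close>.
\<close>

lemma dependence_sums:
  assumes "dependence w c"
  shows "(\<Sum>k\<in>UNIV. corner w k) = 0"
    and "(\<Sum>k\<in>UNIV. corner w k * fst (corner c k)) = 0"
    and "(\<Sum>k\<in>UNIV. corner w k * fst (snd (corner c k))) = 0"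
    and "(\<Sum>k\<in>UNIV. corner w k * snd (snd (corner c k))) = 0"
proof -
  obtain a a' b b' d d' where c: "c = ((a, a'), (b, b'), (d, d'))" by (metis surj_pair)
  obtain u u' v v' t t' where w: "w = ((u, u'), (v, v'), (t, t'))" by (metis surj_pair)
  show "(\<Sum>k\<in>UNIV. corner w k) = 0"
    "(\<Sum>k\<in>UNIV. corner w k * fst (corner c k)) = 0"
    "(\<Sum>k\<in>UNIV. corner w k * fst (snd (corner c k))) = 0"
    "(\<Sum>k\<in>UNIV. corner w k * snd (snd (corner c k))) = 0"
    using assms unfolding sum_signed sum_3 c w by (simp_all add: case_prod_beta add_ac)
qed

lemma separates_iff:
  "separates h c d \<longleftrightarrow>
     (\<forall>p\<in>set (vertices c). 0 < height h p \<or> height h p = 0 \<and> p \<in> set (vertices d)) \<and>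
     (\<forall>p\<in>set (vertices d). height h p < 0 \<or> height h p = 0 \<and> p \<in> set (vertices c)) \<and>
     (\<exists>p\<in>set (vertices c). 0 < height h p) \<and> (\<exists>p\<in>set (vertices d). height h p < 0)"
  by (simp add: separates_def every_iff any_iff admissible_iff)

lemma octahedra_distinct: "every (\<lambda>(c, _). distinct (vertices c)) octahedra"
  by code_simp

lemma apart_sorted: "apart cs hss \<Longrightarrow> sorted_wrt (\<lambda>c d. \<exists>h. separates h c d) cs"
proof (induction cs hss rule: apart.induct)
  case (1 c cs hs hss)
  then have l: "list_all2 (\<lambda>d h. separates h c d) cs hs" "apart cs hss" by auto
  have "\<exists>h. separates h c d" if "d \<in> set cs" for d
    using that l(1) by (metis in_set_conv_nth list_all2_nthD)
  then show ?case using "1.IH" l by (simp del: split_paired_Ex)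
qed auto

lemma octahedra_separated:
  assumes "c \<in> set (map fst octahedra)" "d \<in> set (map fst octahedra)" "c \<noteq> d"
  shows "\<exists>h. separates h c d \<or> separates h d c"
proof -
  let ?cs = "map fst octahedra"
  obtain i j where "i < length ?cs" "c = ?cs ! i" "j < length ?cs" "d = ?cs ! j"
    using assms(1,2) by (metis in_set_conv_nth)
  then show ?thesis
    using sorted_wrt_nth_less[OF apart_sorted[OF octahedra_apart]] assms(3)
    by (metis linorder_neqE_nat)
qed

lemma card_octahedra: "card (set (map fst octahedra)) = 23"
proof -
  have "\<not> separates h c c" for h c unfolding separates_iff by force
  then have "distinct (map fst octahedra)"
    using sorted_wrt_nth_less[OF apart_sorted[OF octahedra_apart]]
    unfolding distinct_conv_nth by (metis linorder_neqE_nat)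
  then show ?thesis using distinct_card[of "map fst octahedra"] length_octahedra by simp
qed

lemma facet_okE:
  assumes "facet_ok c T"
  obtains (inner) d where "d \<in> set (map fst octahedra)" "d \<noteq> c" "set T \<subseteq> set (vertices d)"
  | (outer) B h where "B \<in> set (facets outer)" "set T = set B" "h \<in> set walls"
      "\<forall>p\<in>set (vertices c). 0 < height h p \<or> height h p = 0 \<and> p \<in> set T" "\<forall>p\<in>set T. height h p = 0"
proof (cases "\<exists>d\<in>set (map fst octahedra). d \<noteq> c \<and> set T \<subseteq> set (vertices d)")
  case True
  then show thesis using inner by blast
next
  case False
  have "\<not> any (\<lambda>(d, _). if subset_list T (vertices d) then d \<noteq> c else False) octahedra"
  proof
    assume "any (\<lambda>(d, _). if subset_list T (vertices d) then d \<noteq> c else False) octahedra"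
    then obtain d v where "(d, v) \<in> set octahedra" "set T \<subseteq> set (vertices d)" "d \<noteq> c"
      unfolding any_iff subset_list_iff by (auto split: if_splits)
    then show False using False by force
  qed
  then have B: "\<exists>B\<in>set (facets outer). if set T \<subseteq> set B then set B \<subseteq> set T else False"
    and h: "\<exists>h\<in>set walls. (\<forall>p\<in>set (vertices c). 0 < height h p \<or> height h p = 0 \<and> p \<in> set T) \<and>
              (\<forall>p\<in>set T. height h p = 0)"
    using assms by (simp_all only: facet_ok_def if_False any_iff every_iff subset_list_iff admissible_iff)
  from B obtain B where "B \<in> set (facets outer)" "set T = set B"
    by (metis subset_antisym)
  moreover from h obtain h where "h \<in> set walls"
    "\<forall>p\<in>set (vertices c). 0 < height h p \<or> height h p = 0 \<and> p \<in> set T" "\<forall>p\<in>set T. height h p = 0"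
    by (elim bexE conjE)
  ultimately show thesis by (rule outer)
qed

lemma outer_facet_okE:
  assumes "outer_facet_ok B"
  obtains c T where "c \<in> set (map fst octahedra)" "T \<in> set (facets c)" "set T = set B"
    "\<And>d. d \<in> set (map fst octahedra) \<Longrightarrow> set B \<subseteq> set (vertices d) \<Longrightarrow> d = c"
proof -
  let ?L = "filter (\<lambda>(c, _). subset_list B (vertices c)) octahedra"
  obtain c w where L: "?L = [(c, w)]"
    and T: "any (\<lambda>T. if subset_list T B then subset_list B T else False) (facets c)"
    using assms unfolding outer_facet_ok_def by (auto split: list.splits)
  have uniq: "d = c" if d: "d \<in> set (map fst octahedra)" "set B \<subseteq> set (vertices d)" for d
  proof -
    obtain v where "(d, v) \<in> set octahedra" using d(1) by auto
    then have "(d, v) \<in> set ?L" using d(2) by (simp add: subset_list_iff)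
    then show ?thesis unfolding L by simp
  qed
  have "(c, w) \<in> set ?L" unfolding L by simp
  then have "(c, w) \<in> set octahedra" by (simp only: set_filter mem_Collect_eq)
  then have c: "c \<in> set (map fst octahedra)" by force
  obtain T where "T \<in> set (facets c)" "set T = set B"
    using T unfolding any_iff subset_list_iff by (metis subset_antisym)
  then show thesis by (rule that[OF c _ _ uniq])
qed

section \<open>Transport to an arbitrary tetrahedron\<close>

lemma affine_independent_functional:
  fixes C :: "'a::euclidean_space set"
  assumes C: "\<not> affine_dependent C" and s: "s \<in> C"
  shows "\<exists>n. \<forall>x\<in>C. n \<bullet> (x - s) = v x - v s"
proof -
  have ind: "independent ((\<lambda>x. - s + x) ` (C - {s}))"
    using affine_dependent_iff_dependent2[OF s] C by simp
  obtain f :: "'a \<Rightarrow> real" where f: "linear f"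
    "\<forall>y\<in>(\<lambda>x. - s + x) ` (C - {s}). f y = v (s + y) - v s"
    using linear_independent_extend[OF ind, of "\<lambda>y. v (s + y) - v s"] by (elim exE conjE)
  have "adjoint f 1 \<bullet> (x - s) = v x - v s" if "x \<in> C" for x
  proof (cases "x = s")
    case False
    then have "f (- s + x) = v (s + (- s + x)) - v s" using f(2) that by blast
    then show ?thesis using adjoint_works[OF f(1), of "x - s" 1] by (simp add: inner_commute)
  qed simp
  then show ?thesis by blast
qed

text \<open>
  The affine coordinates in which the four vertices of the tetrahedron become \<open>(\<plusminus>5,0,5)\<close> and
  \<open>(0,\<plusminus>5,-5)\<close>.  Affine functions of the coordinates are affine functions on the space, so every
  sign computed from the integer coordinates has its geometric meaning.
\<close>

lemma tetrahedron_coordinates: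
  fixes C :: "(real ^ 3) set"
  assumes C: "\<not> affine_dependent C" "card C = 4"
  obtains X :: "point \<Rightarrow> real ^ 3" and E U V W where
    "\<And>x y z. X (x, y, z) = E + of_int x *\<^sub>R U + of_int y *\<^sub>R V + of_int z *\<^sub>R W"
    "C = X ` {(5,0,5), (-5,0,5), (0,5,-5), (0,-5,-5)}"
    "\<And>h. \<exists>a b. \<forall>p. a \<bullet> X p = b + of_int (height h p)"
proof -
  obtain s0 s1 s2 s3 where s: "C = {s0, s1, s2, s3}" "distinct [s0, s1, s2, s3]"
    using C(2) by (auto simp: numeral_eq_Suc card_Suc_eq)
  define E where "E = (1/4) *\<^sub>R (s0 + s1 + s2 + s3)"
  define U where "U = (1/10) *\<^sub>R (s0 - s1)"
  define V where "V = (1/10) *\<^sub>R (s2 - s3)"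
  define W where "W = (1/20) *\<^sub>R (s0 + s1 - s2 - s3)"
  define X where "X = (\<lambda>(x, y, z). E + of_int x *\<^sub>R U + of_int y *\<^sub>R V + of_int z *\<^sub>R W)"
  have X: "X (x, y, z) = E + of_int x *\<^sub>R U + of_int y *\<^sub>R V + of_int z *\<^sub>R W" for x y z
    by (simp add: X_def)
  have "X (5,0,5) = s0" "X (-5,0,5) = s1" "X (0,5,-5) = s2" "X (0,-5,-5) = s3"
    unfolding X E_def U_def V_def W_def by (simp_all add: vec_eq_iff field_simps)
  then have CX: "C = X ` {(5,0,5), (-5,0,5), (0,5,-5), (0,-5,-5)}" using s(1) by simp
  \<comment> \<open>An affine function with prescribed values at the four vertices exists; the values are those of
  \<open>h\<close>, shifted so that the one at \<open>s1\<close> is zero.\<close>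
  have "\<exists>a b. \<forall>p. a \<bullet> X p = b + of_int (height h p)" for h
  proof -
    obtain k l m d where h: "h = ((k, l, m), d)" by (metis surj_pair)
    let ?v = "(\<lambda>_. 0)(s0 := 10 * real_of_int k, s2 := 5 * real_of_int k - 10 * m + 5 * l,
                 s3 := 5 * real_of_int k - 10 * m - 5 * l)"
    obtain n where "\<forall>x\<in>C. n \<bullet> (x - s1) = ?v x - ?v s1"
      using affine_independent_functional[OF C(1), of s1 ?v] s(1) by auto
    then have n: "n \<bullet> s0 = n \<bullet> s1 + 10 * k" "n \<bullet> s2 = n \<bullet> s1 + (5 * real_of_int k - 10 * m + 5 * l)"
      "n \<bullet> s3 = n \<bullet> s1 + (5 * real_of_int k - 10 * m - 5 * l)"
      using s(2) unfolding s(1) by (auto simp: inner_diff_right)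
    have "n \<bullet> U = k" "n \<bullet> V = l" "n \<bullet> W = m"
      unfolding U_def V_def W_def by (simp_all add: inner_add_right inner_diff_right n)
    then have "n \<bullet> X p = (n \<bullet> E - d) + of_int (height h p)" for p
      by (cases p) (simp add: X h inner_add_right mult.commute)
    then show ?thesis by blast
  qed
  then show thesis using that X CX by blast
qed

theorem theorem1p6:
  fixes S :: "(real ^ 3) set"
  assumes "3 simplex S"
  shows "\<exists>\<Delta>. cross_polytopal_subdivision \<Delta> S \<and>
             \<not> proper_subdivision \<Delta> S \<and>
             num_cells 3 \<Delta> = 23 \<and>
             complex_boundary \<Delta> \<simeq>\<^sub>c
               boundary_complex (regular_cross_polytope :: (real ^ 3) set)"
proof -
  obtain C where C: "\<not> affine_dependent C" "card C = 4" "S = convex hull C"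
    using assms unfolding simplex_def by auto
  obtain X :: "point \<Rightarrow> real ^ 3" and E U V W where
    X: "\<And>x y z. X (x, y, z) = E + of_int x *\<^sub>R U + of_int y *\<^sub>R V + of_int z *\<^sub>R W"
    and CX: "C = X ` {(5,0,5), (-5,0,5), (0,5,-5), (0,-5,-5)}"
    and aff: "\<And>h. \<exists>a b. \<forall>p. a \<bullet> X p = b + of_int (height h p)"
    by (rule tetrahedron_coordinates[OF C(1,2)]) (rule that)

  have inj_X: "inj X"
  proof (rule injI)
    fix p p' assume eq: "X p = X p'"
    have h: "height h p = height h p'" for h
    proof -
      obtain a b where "\<forall>p. a \<bullet> X p = b + of_int (height h p)" using aff by blast
      then show ?thesis using eq by (metis add_left_cancel of_int_eq_iff)
    qed
    show "p = p'"
      using h[of "((1,0,0),0)"] h[of "((0,1,0),0)"] h[of "((0,0,1),0)"] by (cases p; cases p') simp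
  qed

  let ?K = "set (map fst octahedra)"
  let ?q = "\<lambda>c. X \<circ> corner c"
  have range_q: "range (?q c) = X ` set (vertices c)" for c
    by (simp only: image_comp[symmetric] range_corner)
  have q_mem: "X p \<in> range (?q c) \<longleftrightarrow> p \<in> set (vertices c)" for p c
    unfolding range_q by (simp add: inj_image_mem_iff[OF inj_X])
  have in_S: "X p \<in> S" if wall: "\<And>h. h \<in> set walls \<Longrightarrow> 0 \<le> height h p" for p
  proof -
    obtain x y z where p: "p = (x, y, z)" by (metis surj_pair)
    let ?I = "{(5,0,5), (-5,0,5), (0,5,-5), (0,-5,-5)} :: point set"
    \<comment> \<open>The barycentric coordinates of \<open>p\<close> are the values of the four wall functions divided by 20;
    at the vertex \<open>(u, v, w)\<close> this is \<open>n (u, v, w) / 100\<close>.\<close>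
    define n where "n = (\<lambda>(u, v, w). 25 + w * z + 2 * (u * x + v * y))"
    have "(\<Sum>c\<in>?I. (of_int (n c) / 100) *\<^sub>R X c) \<in> convex hull C"
    proof (rule convex_sum)
      show "(\<Sum>c\<in>?I. of_int (n c) / (100::real)) = 1" by (simp add: n_def field_simps)
      show "0 \<le> of_int (n c) / (100::real)" if c: "c \<in> ?I" for c
      proof -
        have "0 \<le> 2 * x + z + 5" "0 \<le> - 2 * x + z + 5" "0 \<le> 2 * y - z + 5" "0 \<le> - 2 * y - z + 5"
          using wall[of "((2,0,1),5)"] wall[of "((-2,0,1),5)"] wall[of "((0,2,-1),5)"] wall[of "((0,-2,-1),5)"]
          unfolding walls_def p by simp_all
        then have "0 \<le> n c" using c unfolding n_def by auto
        then show ?thesis by simp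
      qed
      show "X c \<in> convex hull C" if "c \<in> ?I" for c using that unfolding CX by (blast intro: hull_inc)
    qed auto
    moreover have "(\<Sum>c\<in>?I. (of_int (n c) / 100) *\<^sub>R X c) = X p"
      unfolding p n_def by (simp add: X vec_eq_iff field_simps)
    ultimately show ?thesis using C(3) by simp
  qed
  have wall_S: "b \<le> a \<bullet> x"
    if "h \<in> set walls" "\<forall>p. a \<bullet> X p = b + of_int (height h p)" "x \<in> S" for h a b x
  proof (rule hull_ge)
    show "x \<in> convex hull C" using that(3) C(3) by simp
    fix v assume "v \<in> C"
    then obtain p where p: "v = X p" "p \<in> {(5,0,5), (-5,0,5), (0,5,-5), (0,-5,-5)}"
      unfolding CX by blast
    then have "0 \<le> height h p" using that(1) unfolding walls_def by auto
    then show "b \<le> a \<bullet> v" using that(2) p(1) by (metis le_add_same_cancel1 of_int_0_le_iff)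
  qed
  have closed: "convex S" "closed S"
    using C(3) CX by (auto intro!: compact_imp_closed finite_imp_compact_convex_hull)

  interpret octahedral_dissection ?K ?q "X \<circ> corner outer" S
  proof
    show "finite ?K" "?K \<noteq> {}" using length_octahedra by auto
    show "CARD(3) = DIM(real ^ 3)" by simp
    show "convex S" "closed S" by fact+
    show "inj (X \<circ> corner outer)"
      by (intro inj_compose inj_X inj_corner) (simp add: outer_def)
  next
    fix c assume "c \<in> ?K"
    then obtain w where "(c, w) \<in> set octahedra" by auto
    then have "0 \<le> height h p" if "p \<in> set (vertices c)" "h \<in> set walls" for h p
      using octahedra_inside that by (auto simp: every_iff)
    then have "X p \<in> S" if "p \<in> set (vertices c)" for p
      using in_S that by blast
    then show "range (?q c) \<subseteq> S" unfolding range_q by blast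
  next
    fix c and i :: 3 assume "c \<in> ?K"
    then obtain u v w where "(c, u, v, w) \<in> set octahedra" by auto
    then have bal: "balanced (c, u, v, w)" using octahedra_balanced by (auto simp: every_iff)
    define t where "t = (if i = 1 then u else if i = 2 then v else w)"
    obtain u1 u2 u3 v1 v2 v3 w1 w2 w3 where uvw: "u = (u1, u2, u3)" "v = (v1, v2, v3)" "w = (w1, w2, w3)"
      by (metis surj_pair)
    have dep: "dependence t c" using bal unfolding t_def uvw by (simp del: dependence.simps)
    have pos: "0 < corner t k" if "fst k \<noteq> i" for k
      using bal that exhaust_3[of i] exhaust_3[of "fst k"] unfolding t_def uvw
      by (cases k) (auto simp del: dependence.simps simp: case_prod_beta)
    have "(\<Sum>k\<in>UNIV. real_of_int (corner t k) *\<^sub>R X (corner c k)) =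
        of_int (\<Sum>k\<in>UNIV. corner t k) *\<^sub>R E + of_int (\<Sum>k\<in>UNIV. corner t k * fst (corner c k)) *\<^sub>R U +
        of_int (\<Sum>k\<in>UNIV. corner t k * fst (snd (corner c k))) *\<^sub>R V +
        of_int (\<Sum>k\<in>UNIV. corner t k * snd (snd (corner c k))) *\<^sub>R W"
    proof -
      have "X p = E + of_int (fst p) *\<^sub>R U + of_int (fst (snd p)) *\<^sub>R V + of_int (snd (snd p)) *\<^sub>R W" for p
        using X by (metis prod.collapse)
      then show ?thesis by (simp add: scaleR_sum_left scaleR_right_distrib sum.distrib)
    qed
    also have "\<dots> = 0" by (simp add: dependence_sums[OF dep])
    finally show "balanced_diagonal (?q c) i"
      unfolding balanced_diagonal_def
      by (intro exI[of _ "\<lambda>k. real_of_int (corner t k)"])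
         (simp add: pos dependence_sums(1)[OF dep] flip: of_int_sum)
  next
    fix c d assume "c \<in> ?K" "d \<in> ?K" "c \<noteq> d"
    then obtain h where h: "separates h c d \<or> separates h d c" using octahedra_separated by blast
    obtain a b where ab: "\<forall>p. a \<bullet> X p = b + of_int (height h p)" using aff by blast
    obtain a b and g :: "point \<Rightarrow> int" where ab: "\<And>p. a \<bullet> X p = b + of_int (g p)"
      and g: "\<forall>p\<in>set (vertices c). 0 < g p \<or> g p = 0 \<and> p \<in> set (vertices d)"
        "\<forall>p\<in>set (vertices d). g p < 0 \<or> g p = 0 \<and> p \<in> set (vertices c)"
        "\<exists>p\<in>set (vertices c). 0 < g p"
    proof (cases "separates h c d")
      case True
      then show thesis unfolding separates_iff by (intro that[of a b "height h"]) (use ab in blast)+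
    next
      case False
      then have "separates h d c" using h by blast
      then show thesis
        unfolding separates_iff
        by (intro that[of "- a" "- b" "\<lambda>p. - height h p"]) (simp_all add: ab)
    qed
    show "\<exists>a b. (\<forall>x\<in>range (?q c). b < a \<bullet> x \<or> a \<bullet> x = b \<and> x \<in> range (?q d)) \<and>
            (\<forall>x\<in>range (?q d). a \<bullet> x < b \<or> a \<bullet> x = b \<and> x \<in> range (?q c)) \<and>
            (\<exists>x\<in>range (?q c). b < a \<bullet> x)"
      unfolding range_q using g by (intro exI[of _ a] exI[of _ b]) (auto simp: ab)
  next
    fix c and \<sigma> :: "3 \<Rightarrow> bool" assume "c \<in> ?K"
    then obtain w where w: "(c, w) \<in> set octahedra" by auto
    have inj_c: "inj (corner c)"
      using octahedra_distinct w by (intro inj_corner) (auto simp: every_iff)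
    obtain T where T: "T \<in> set (facets c)" "corner c ` orthant \<sigma> = set T"
      using orthant_in_facets[of c \<sigma>] by (elim bexE)
    have img: "?q c ` orthant \<sigma> = X ` set T" by (simp only: image_comp[symmetric] T(2))
    have "facet_ok c T" using octahedra_facets w T(1) by (fastforce simp: every_iff)
    then show "(\<exists>d\<in>?K. d \<noteq> c \<and> ?q c ` orthant \<sigma> \<subseteq> range (?q d)) \<or>
      (\<exists>\<rho>. ?q c ` orthant \<sigma> = (X \<circ> corner outer) ` orthant \<rho> \<and>
           (\<exists>a b. supports (?q c) \<sigma> a b \<and> (\<forall>x\<in>S. b \<le> a \<bullet> x)))"
    proof (cases rule: facet_okE)
      case (inner d)
      then show ?thesis unfolding img range_q by blast
    next
      case (outer B h)
      obtain \<rho> where \<rho>: "corner outer ` orthant \<rho> = set B" 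
        using facets_orthant[OF outer(1)] by (elim exE)
      obtain a b where ab: "\<forall>p. a \<bullet> X p = b + of_int (height h p)" using aff by blast
      then have ab': "a \<bullet> X p = b + of_int (height h p)" for p by blast
      have "supports (?q c) \<sigma> a b"
        unfolding supports_iff
      proof
        fix k
        have "corner c k \<in> set (vertices c)" unfolding range_corner[symmetric] by simp
        moreover have "corner c k \<in> set T \<longleftrightarrow> k \<in> orthant \<sigma>"
          unfolding T(2)[symmetric] by (rule inj_image_mem_iff[OF inj_c])
        ultimately show "b \<le> a \<bullet> ?q c k \<and> (a \<bullet> ?q c k = b \<longleftrightarrow> k \<in> orthant \<sigma>)"
          using outer(4,5) by (fastforce simp: ab')
      qed
      moreover have "\<forall>x\<in>S. b \<le> a \<bullet> x" using wall_S[OF outer(3) ab] by blast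
      moreover have "?q c ` orthant \<sigma> = (X \<circ> corner outer) ` orthant \<rho>"
        unfolding img by (simp only: image_comp[symmetric] \<rho> outer(2))
      ultimately show ?thesis by blast
    qed
  next
    fix \<rho> :: "3 \<Rightarrow> bool"
    obtain B where B: "B \<in> set (facets outer)" "corner outer ` orthant \<rho> = set B"
      using orthant_in_facets[of outer \<rho>] by (elim bexE)
    have img: "(X \<circ> corner outer) ` orthant \<rho> = X ` set B" by (simp only: image_comp[symmetric] B(2))
    have "outer_facet_ok B" using outer_facets B(1) by (simp add: every_iff)
    then obtain c T where c: "c \<in> ?K" "T \<in> set (facets c)" "set T = set B"
      "\<And>d. d \<in> ?K \<Longrightarrow> set B \<subseteq> set (vertices d) \<Longrightarrow> d = c"
      by (rule outer_facet_okE) (rule that)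
    obtain \<sigma> where \<sigma>: "corner c ` orthant \<sigma> = set T" 
      using facets_orthant[OF c(2)] by (elim exE)
    have "?q c ` orthant \<sigma> = X ` set B" by (simp only: image_comp[symmetric] \<sigma> c(3))
    moreover have "d = c" if "d \<in> ?K" "X ` set B \<subseteq> range (?q d)" for d
      using c(4)[OF that(1)] that(2) unfolding range_q inj_image_subset_iff[OF inj_X] by blast
    ultimately show "\<exists>c\<in>?K. \<exists>\<sigma>. ?q c ` orthant \<sigma> = (X \<circ> corner outer) ` orthant \<rho> \<and>
      (\<forall>d\<in>?K. (X \<circ> corner outer) ` orthant \<rho> \<subseteq> range (?q d) \<longrightarrow> d = c)"
      unfolding img using c(1) by blast
  qed

  interpret U: cross_polytope_vertices "unit_vertex :: 3 \<times> bool \<Rightarrow> real ^ 3"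
    by (rule cross_polytope_vertices_unit)
  have boundary: "{J :: (3 \<times> bool) set. antipode_free J} \<simeq>\<^sub>c
      boundary_complex (regular_cross_polytope :: (real ^ 3) set)"
    using U.boundary_complex_equiv by (simp add: regular_cross_polytope_eq)
  have "face_lattice (regular_cross_polytope :: (real ^ 3) set) \<simeq>\<^sub>c
      insert UNIV {J :: (3 \<times> bool) set. antipode_free J}"
    using comb_equiv_sym[OF U.face_lattice_equiv] by (simp add: regular_cross_polytope_eq)
  then have "cross_polytopal_subdivision subdivision S"
    by (rule is_cross_polytopal_subdivision)
  moreover have "num_cells 3 subdivision = 23"
    using num_cells_subdivision card_octahedra by simp
  moreover have "complex_boundary subdivision \<simeq>\<^sub>c boundary_complex (regular_cross_polytope :: (real ^ 3) set)"
    using comb_equiv_trans[OF comb_equiv_sym[OF complex_boundary_equiv] boundary] .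
  moreover have "\<not> proper_subdivision subdivision S"
  proof
    assume "proper_subdivision subdivision S"
    then have "{J :: (3 \<times> bool) set. antipode_free J} \<simeq>\<^sub>c boundary_complex S"
      unfolding proper_subdivision_def by (rule comb_equiv_trans[OF complex_boundary_equiv])
    \<comment> \<open>The octahedron has 27 proper faces, the empty one included, more than the 16 sets of vertices
    of the tetrahedron.\<close>
    then have "card {J :: (3 \<times> bool) set. antipode_free J} = card (boundary_complex S)"
      unfolding comb_equiv_def using bij_betw_same_card by blast
    moreover have "finite C" using C(2) card.infinite by fastforce
    moreover have "boundary_complex S \<subseteq> (\<lambda>W. convex hull W) ` Pow C"
      using face_of_hull_eq[OF \<open>finite C\<close>] unfolding boundary_complex_def C(3) by blast
    then have "card (boundary_complex S) \<le> card (Pow C)"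
      using \<open>finite C\<close> by (meson card_image_le card_mono finite_Pow_iff finite_imageI order_trans)
    ultimately show False by (simp add: card_antipode_free card_Pow C(2))
  qed
  ultimately show ?thesis by blast
qed

end
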